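(* A complete list of $G^{\rm ess}$-inequivalent proper (nonzero) subalgebras of the essential Lie invariance algebra $\mathfrak g^{\rm ess}=\langle\mathcal P^t,\mathcal D,\mathcal K,\mathcal G^x,\mathcal P^x,\mathcal I\rangle$ of the heat equation $u_t=u_{xx}$ is exhausted by the following subalgebras, where $\delta\in\{-1,0,1\}$, $\mu\in\mathbb R_{\geqslant0}$ and $\nu\in\mathbb R$: 1D: $\mathfrak s_{1.1}=\langle\mathcal P^t+\mathcal G^x\rangle$, $\mathfrak s_{1.2}^\delta=\langle\mathcal P^t+\delta\mathcal I\rangle$, $\mathfrak s_{1.3}^\mu=\langle\mathcal D+\mu\mathcal I\rangle$, $\mathfrak s_{1.4}^\nu=\langle\mathcal P^t+\mathcal K+\nu\mathcal I\rangle$, $\mathfrak s_{1.5}=\langle\mathcal P^x\rangle$, $\mathfrak s_{1.6}=\langle\mathcal I\rangle$; 2D: $\mathfrak s_{2.1}^\nu=\langle\mathcal P^t,\mathcal D+\nu\mathcal I\rangle$, $\mathfrak s_{2.2}=\langle\mathcal P^t+\mathcal G^x,\mathcal I\rangle$, $\mathfrak s_{2.3}^\delta=\langle\mathcal P^t+\delta\mathcal I,\mathcal P^x\rangle$, $\mathfrak s_{2.4}=\langle\mathcal P^t,\mathcal I\rangle$, $\mathfrak s_{2.5}^\nu=\langle\mathcal D+\nu\mathcal I,\mathcal P^x\rangle$, $\mathfrak s_{2.6}=\langle\mathcal D,\mathcal I\rangle$, $\mathfrak s_{2.7}=\langle\mathcal P^t+\mathcal K,\mathcal I\rangle$, $\mathfrak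 s_{2.8}=\langle\mathcal P^x,\mathcal I\rangle$; 3D: $\mathfrak s_{3.1}=\langle\mathcal P^t,\mathcal D,\mathcal K\rangle$, $\mathfrak s_{3.2}^\nu=\langle\mathcal P^t,\mathcal D+\nu\mathcal I,\mathcal P^x\rangle$, $\mathfrak s_{3.3}=\langle\mathcal P^t,\mathcal D,\mathcal I\rangle$, $\mathfrak s_{3.4}=\langle\mathcal P^t+\mathcal G^x,\mathcal P^x,\mathcal I\rangle$, $\mathfrak s_{3.5}=\langle\mathcal P^t,\mathcal P^x,\mathcal I\rangle$, $\mathfrak s_{3.6}=\langle\mathcal D,\mathcal P^x,\mathcal I\rangle$, $\mathfrak s_{3.7}=\langle\mathcal G^x,\mathcal P^x,\mathcal I\rangle$; 4D: $\mathfrak s_{4.1}=\langle\mathcal P^t,\mathcal D,\mathcal K,\mathcal I\rangle$, $\mathfrak s_{4.2}=\langle\mathcal P^t,\mathcal D,\mathcal P^x,\mathcal I\rangle$, $\mathfrak s_{4.3}=\langle\mathcal P^t,\mathcal G^x,\mathcal P^x,\mathcal I\rangle$, $\mathfrak s_{4.4}=\langle\mathcal D,\mathcal G^x,\mathcal P^x,\mathcal I\rangle$, $\mathfrak s_{4.5}=\langle\mathcal P^t+\mathcal K,\mathcal G^x,\mathcal P^x,\mathcal I\rangle$; 5D: $\mathfrak s_{5.1}=\langle\mathcal P^t,\mathcal D,\mathcal G^x,\mathcal P^x,\mathcal I\rangle$. That is, every proper nonzero subalgebra of $\mathfrak g^{\rm ess}$ is $G^{\rm ess}$-equivalent to one of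 the listed subalgebras, and distinct listed subalgebras (including those with distinct parameter values within a family) are $G^{\rm ess}$-inequivalent.
   Context: Angle brackets denote the real linear span. The basis vector fields on $\mathbb R^3_{t,x,u}$ are $\mathcal P^t=\partial_t$, $\mathcal D=2t\partial_t+x\partial_x-\tfrac12u\partial_u$, $\mathcal K=t^2\partial_t+tx\partial_x-\tfrac14(x^2+2t)u\partial_u$, $\mathcal G^x=t\partial_x-\tfrac12xu\partial_u$, $\mathcal P^x=\partial_x$, $\mathcal I=u\partial_u$. Up to antisymmetry, their nonzero commutation relations are $[\mathcal D,\mathcal P^t]=-2\mathcal P^t$, $[\mathcal D,\mathcal K]=2\mathcal K$, $[\mathcal P^t,\mathcal K]=\mathcal D$, $[\mathcal P^t,\mathcal G^x]=\mathcal P^x$, $[\mathcal D,\mathcal G^x]=\mathcal G^x$, $[\mathcal D,\mathcal P^x]=-\mathcal P^x$, $[\mathcal K,\mathcal P^x]=-\mathcal G^x$, $[\mathcal G^x,\mathcal P^x]=\tfrac12\mathcal I$. $G^{\rm ess}$ is the Lie group of transformations $$\tilde t=\frac{\alpha t+\beta}{\gamma t+\delta},\quad \tilde x=\frac{x+\lambda_1t+\lambda_0}{\gamma t+\delta},\quad \tilde u=\sigma\sqrt{|\gamma t+\delta|}\,\exp\!\left(\frac{\gamma (x+\lambda_1t+\lambda_0)^2}{4(\gamma t+\delta)}-\frac{\lambda_1}2x-\frac{\lambda_1^2}4t\right)u$$ with real parameters, $\alpha\delta-\beta\gamma=1$, $\sigma\ne0$ (here $\delta$ is a group parameter, unrelated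 to the $\delta$ of the list). Each is considered on its natural domain $\{\gamma t+\delta\ne0\}$, and the multiplication is composition extended by continuity to the natural domain of the resulting transformation. The group acts on $\mathfrak g^{\rm ess}$ by pushforward of vector fields, and this action coincides with the inner automorphism group of $\mathfrak g^{\rm ess}$. Two subalgebras are $G^{\rm ess}$-equivalent if one is mapped onto the other by the pushforward by some element of $G^{\rm ess}$. *)

theory Defs
  imports "HOL-Analysis.Analysis" "HOL-Library.Function_Algebras"
begin

text \<open>Pointwise real vector space structure on functions, so that \<^const>\<open>span\<close>,
  \<^const>\<open>subspace\<close> and \<^const>\<open>dim\<close> apply to vector fields.\<close>

instantiation "fun" :: (type, scaleR) scaleR
begin

definition scaleR_fun :: "real \<Rightarrow> ('a \<Rightarrow> 'b) \<Rightarrow> 'a \<Rightarrow> 'b"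
  where "scaleR_fun c f = (\<lambda>x. c *\<^sub>R f x)"

instance ..

end

instance "fun" :: (type, real_vector) real_vector
  by standard (simp_all add: scaleR_fun_def plus_fun_def fun_eq_iff scaleR_add_right scaleR_add_left)

type_synonym point = "real \<times> real \<times> real"

text \<open>A point is \<open>(t, x, u)\<close>. A vector field \<open>a \<partial>\<^sub>t + b \<partial>\<^sub>x + c \<partial>\<^sub>u\<close> is the map
  sending a point to its component triple \<open>(a, b, c)\<close>.\<close>

type_synonym vfield = "point \<Rightarrow> point"

definition lie_bracket :: "vfield \<Rightarrow> vfield \<Rightarrow> vfield"
  where "lie_bracket X Y =
    (\<lambda>p. frechet_derivative Y (at p) (X p) - frechet_derivative X (at p) (Y p))"

definition vP\<^sub>t :: vfield where "vP\<^sub>t = (\<lambda>(t, x, u). (1, 0, 0))"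
definition vD :: vfield where "vD = (\<lambda>(t, x, u). (2 * t, x, - (1/2) * u))"
definition vK :: vfield where "vK = (\<lambda>(t, x, u). (t\<^sup>2, t * x, - (1/4) * (x\<^sup>2 + 2 * t) * u))"
definition vG\<^sub>x :: vfield where "vG\<^sub>x = (\<lambda>(t, x, u). (0, t, - (1/2) * x * u))"
definition vP\<^sub>x :: vfield where "vP\<^sub>x = (\<lambda>(t, x, u). (0, 1, 0))"
definition vI :: vfield where "vI = (\<lambda>(t, x, u). (0, 0, u))"

definition g_ess :: "vfield set"
  where "g_ess = span {vP\<^sub>t, vD, vK, vG\<^sub>x, vP\<^sub>x, vI}"

definition lie_subalgebra :: "vfield set \<Rightarrow> vfield set \<Rightarrow> bool"
  where "lie_subalgebra s g \<longleftrightarrow>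
    s \<subseteq> g \<and> subspace s \<and> (\<forall>X\<in>s. \<forall>Y\<in>s. lie_bracket X Y \<in> s)"

definition proper_nonzero_subalgebra :: "vfield set \<Rightarrow> bool"
  where "proper_nonzero_subalgebra s \<longleftrightarrow> lie_subalgebra s g_ess \<and> s \<noteq> {0} \<and> s \<noteq> g_ess"

text \<open>The parameters \<open>\<kappa>\<^sub>1, \<kappa>\<^sub>0\<close> are usually written with a lambda, which is reserved here.\<close>

definition ess_map ::
    "real \<Rightarrow> real \<Rightarrow> real \<Rightarrow> real \<Rightarrow> real \<Rightarrow> real \<Rightarrow> real \<Rightarrow> point \<Rightarrow> point"
  where "ess_map \<alpha> \<beta> \<gamma> \<delta> \<kappa>\<^sub>1 \<kappa>\<^sub>0 \<sigma> = (\<lambda>(t, x, u).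
    ((\<alpha> * t + \<beta>) / (\<gamma> * t + \<delta>),
     (x + \<kappa>\<^sub>1 * t + \<kappa>\<^sub>0) / (\<gamma> * t + \<delta>),
     \<sigma> * sqrt \<bar>\<gamma> * t + \<delta>\<bar> *
       exp (\<gamma> * (x + \<kappa>\<^sub>1 * t + \<kappa>\<^sub>0)\<^sup>2 / (4 * (\<gamma> * t + \<delta>)) - \<kappa>\<^sub>1 / 2 * x - \<kappa>\<^sub>1\<^sup>2 / 4 * t) * u))"

definition ess_dom :: "real \<Rightarrow> real \<Rightarrow> point set"
  where "ess_dom \<gamma> \<delta> = {(t, x, u). \<gamma> * t + \<delta> \<noteq> 0}"

text \<open>A transformation is a pair of its natural domain and a map; the values of the map
  outside the domain are irrelevant.\<close>

definition G_ess :: "(point set \<times> (point \<Rightarrow> point)) set"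
  where "G_ess = {(ess_dom \<gamma> \<delta>, ess_map \<alpha> \<beta> \<gamma> \<delta> \<kappa>\<^sub>1 \<kappa>\<^sub>0 \<sigma>) | \<alpha> \<beta> \<gamma> \<delta> \<kappa>\<^sub>1 \<kappa>\<^sub>0 \<sigma>.
    \<alpha> * \<delta> - \<beta> * \<gamma> = 1 \<and> \<sigma> \<noteq> 0}"

text \<open>The pushforward of a vector field by \<open>\<Phi> : U \<rightarrow> \<Phi>(U)\<close> is a vector field on \<open>\<Phi>(U)\<close> only.
  Elements of \<^const>\<open>G_ess\<close> are injective on their domain.\<close>

definition pushforward :: "point set \<Rightarrow> (point \<Rightarrow> point) \<Rightarrow> vfield \<Rightarrow> vfield"
  where "pushforward U \<Phi> X =
    (\<lambda>q\<in>\<Phi> ` U. frechet_derivative \<Phi> (at (inv_into U \<Phi> q)) (X (inv_into U \<Phi> q)))"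

text \<open>The set \<open>\<Phi>(U)\<close> is all of space or the complement of a plane \<open>t = const\<close>, hence dense,
  and elements of \<^const>\<open>g_ess\<close> are determined by their restrictions to it. The pushforward
  of \<open>s\<close> is therefore \<open>s'\<close> iff the pushed-forward fields are exactly the restrictions
  of the elements of \<open>s'\<close> to \<open>\<Phi>(U)\<close>.\<close>

definition ess_equivalent :: "vfield set \<Rightarrow> vfield set \<Rightarrow> bool"
  where "ess_equivalent s s' \<longleftrightarrow>
    (\<exists>(U, \<Phi>)\<in>G_ess. pushforward U \<Phi> ` s = (\<lambda>Y. restrict Y (\<Phi> ` U)) ` s')"

datatype label =
    S1_1 | S1_2 real | S1_3 real | S1_4 real | S1_5 | S1_6
  | S2_1 real | S2_2 | S2_3 real | S2_4 | S2_5 real | S2_6 | S2_7 | S2_8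
  | S3_1 | S3_2 real | S3_3 | S3_4 | S3_5 | S3_6 | S3_7
  | S4_1 | S4_2 | S4_3 | S4_4 | S4_5
  | S5_1

fun admissible :: "label \<Rightarrow> bool" where
  "admissible (S1_2 \<delta>) \<longleftrightarrow> \<delta> \<in> {-1, 0, 1}"
| "admissible (S1_3 \<mu>) \<longleftrightarrow> \<mu> \<ge> 0"
| "admissible (S2_3 \<delta>) \<longleftrightarrow> \<delta> \<in> {-1, 0, 1}"
| "admissible _ \<longleftrightarrow> True"

fun listed :: "label \<Rightarrow> vfield set" where
  "listed S1_1 = span {vP\<^sub>t + vG\<^sub>x}"
| "listed (S1_2 \<delta>) = span {vP\<^sub>t + \<delta> *\<^sub>R vI}"
| "listed (S1_3 \<mu>) = span {vD + \<mu> *\<^sub>R vI}"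
| "listed (S1_4 \<nu>) = span {vP\<^sub>t + vK + \<nu> *\<^sub>R vI}"
| "listed S1_5 = span {vP\<^sub>x}"
| "listed S1_6 = span {vI}"
| "listed (S2_1 \<nu>) = span {vP\<^sub>t, vD + \<nu> *\<^sub>R vI}"
| "listed S2_2 = span {vP\<^sub>t + vG\<^sub>x, vI}"
| "listed (S2_3 \<delta>) = span {vP\<^sub>t + \<delta> *\<^sub>R vI, vP\<^sub>x}"
| "listed S2_4 = span {vP\<^sub>t, vI}"
| "listed (S2_5 \<nu>) = span {vD + \<nu> *\<^sub>R vI, vP\<^sub>x}"
| "listed S2_6 = span {vD, vI}"
| "listed S2_7 = span {vP\<^sub>t + vK, vI}"
| "listed S2_8 = span {vP\<^sub>x, vI}"
| "listed S3_1 = span {vP\<^sub>t, vD, vK}"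
| "listed (S3_2 \<nu>) = span {vP\<^sub>t, vD + \<nu> *\<^sub>R vI, vP\<^sub>x}"
| "listed S3_3 = span {vP\<^sub>t, vD, vI}"
| "listed S3_4 = span {vP\<^sub>t + vG\<^sub>x, vP\<^sub>x, vI}"
| "listed S3_5 = span {vP\<^sub>t, vP\<^sub>x, vI}"
| "listed S3_6 = span {vD, vP\<^sub>x, vI}"
| "listed S3_7 = span {vG\<^sub>x, vP\<^sub>x, vI}"
| "listed S4_1 = span {vP\<^sub>t, vD, vK, vI}"
| "listed S4_2 = span {vP\<^sub>t, vD, vP\<^sub>x, vI}"
| "listed S4_3 = span {vP\<^sub>t, vG\<^sub>x, vP\<^sub>x, vI}"
| "listed S4_4 = span {vD, vG\<^sub>x, vP\<^sub>x, vI}"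
| "listed S4_5 = span {vP\<^sub>t + vK, vG\<^sub>x, vP\<^sub>x, vI}"
| "listed S5_1 = span {vP\<^sub>t, vD, vG\<^sub>x, vP\<^sub>x, vI}"

fun listed_dim :: "label \<Rightarrow> nat" where
  "listed_dim S1_1 = 1" | "listed_dim (S1_2 _) = 1" | "listed_dim (S1_3 _) = 1"
| "listed_dim (S1_4 _) = 1" | "listed_dim S1_5 = 1" | "listed_dim S1_6 = 1"
| "listed_dim (S2_1 _) = 2" | "listed_dim S2_2 = 2" | "listed_dim (S2_3 _) = 2"
| "listed_dim S2_4 = 2" | "listed_dim (S2_5 _) = 2" | "listed_dim S2_6 = 2"
| "listed_dim S2_7 = 2" | "listed_dim S2_8 = 2"
| "listed_dim S3_1 = 3" | "listed_dim (S3_2 _) = 3" | "listed_dim S3_3 = 3"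
| "listed_dim S3_4 = 3" | "listed_dim S3_5 = 3" | "listed_dim S3_6 = 3" | "listed_dim S3_7 = 3"
| "listed_dim S4_1 = 4" | "listed_dim S4_2 = 4" | "listed_dim S4_3 = 4"
| "listed_dim S4_4 = 4" | "listed_dim S4_5 = 4"
| "listed_dim S5_1 = 5"

end

theory Submission imports Defs
begin

text \<open>In the basis \<open>P\<^sup>t, D, K, G\<^sup>x, P\<^sup>x, I\<close> the pushforward by an element of \<^const>\<open>G_ess\<close>
  acts on coordinates as an explicit linear map: a translation by a vector of the Heisenberg
  radical followed by the natural action of \<open>SL(2, \<real>)\<close>. Hence equivalence of subalgebras is
  conjugacy of bracket-closed subspaces of \<open>\<real>\<^sup>6\<close>.

  Writing an element as a binary quadratic form (its \<open>sl\<^sub>2\<close>-part), a linear form and a number, the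
  classification splits according to the discriminants of the quadratic forms that occur: after
  conjugation the projection to \<open>sl\<^sub>2\<close> is zero, one of the lines through \<open>P\<^sup>t\<close>, \<open>D\<close>, \<open>P\<^sup>t + K\<close>, the
  Borel subalgebra or everything, and the intersection with the radical is then found from weights.
  For inequivalence one compares the dimension, membership of \<open>I\<close>, the discriminants and the
  cubic invariant combining the discriminant, the central coordinate and the resultant of the two
  forms.\<close>

section \<open>Coordinates and the adjoint action\<close>

text \<open>Maps with \<gamma> \<noteq> 0 are only partially defined, so pushforwards are compared
  off a plane t = const. Components of fields are polynomial, hence still determined there;
  afterwards only linear algebra on tuples remains. Few projections to sl_2 occur, for two reasons.
  Without nonzero forms of discriminant 0 the projection is at most a line: beside a dilation, any
  further element would produce P^t or K by weights, and beside a rotation it would produce a form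
  of discriminant at least 0. With P^t present, bracketing by it lowers the degree of the quadratic,
  so one element of degree two already yields all of sl_2. The parameter ranges come from
  conjugating by SL(2) and not GL(2). Diagonal matrices multiply P^t by a positive square, so a sign
  \<delta> of the I-coefficient survives; relative to P^t the G^x-coefficient scales by a cube, so
  no sign survives there. The Weyl element reverses D and fixes I, which leaves \<mu> \<ge> 0. P^t +
  K is not conjugate to its negative, so \<nu> in \<open>S1_4\<close> keeps its sign.\<close>

type_synonym coords = "real \<times> real \<times> real \<times> real \<times> real \<times> real"

definition vfield_of :: "coords \<Rightarrow> vfield"
  where "vfield_of = (\<lambda>(a, b, c, g, p, i).
    a *\<^sub>R vP\<^sub>t + b *\<^sub>R vD + c *\<^sub>R vK + g *\<^sub>R vG\<^sub>x + p *\<^sub>R vP\<^sub>x + i *\<^sub>R vI)"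

lemma vfield_of_apply:
  "vfield_of (a, b, c, g, p, i) (t, x, u) =
    (a + 2 * b * t + c * t\<^sup>2, b * x + c * t * x + g * t + p,
     (i - b / 2 - c / 4 * (x\<^sup>2 + 2 * t) - g / 2 * x) * u)"
  by (simp add: vfield_of_def plus_fun_def scaleR_fun_def vP\<^sub>t_def vD_def vK_def vG\<^sub>x_def
      vP\<^sub>x_def vI_def algebra_simps)

lemma linear_vfield_of: "linear vfield_of"
  by (rule linearI) (auto simp: vfield_of_def algebra_simps)

text \<open>The first three entries encode the Wronskian f h' - f' h of the quadratics f = a + 2bt +
  ct^2. The next two give the natural action of sl_2 on linear forms, the last one half of the
  symplectic form on them; I is central.\<close>

fun bracket :: "coords \<Rightarrow> coords \<Rightarrow> coords" where
  "bracket (a, b, c, g, p, i) (a', b', c', g', p', i') =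
    (2 * (a * b' - b * a'), a * c' - c * a', 2 * (b * c' - c * b'),
     b * g' - g * b' - c * p' + p * c', a * g' - g * a' - b * p' + p * b', (g * p' - p * g') / 2)"

lemma vfield_of_has_derivative:
  "(vfield_of (a, b, c, g, p, i) has_derivative
     (\<lambda>(dt, dx, du). ((2 * b + 2 * c * t) * dt, (b + c * t) * dx + (c * x + g) * dt,
        (i - b / 2 - c / 4 * (x\<^sup>2 + 2 * t) - g / 2 * x) * du
          - (c / 2 * (x * dx + dt) + g / 2 * dx) * u))) (at (t, x, u))"
proof -
  have eq: "vfield_of (a, b, c, g, p, i) = (\<lambda>q. (a + 2 * b * fst q + c * (fst q)\<^sup>2,
      b * fst (snd q) + c * fst q * fst (snd q) + g * fst q + p,
      (i - b / 2 - c / 4 * ((fst (snd q))\<^sup>2 + 2 * fst q) - g / 2 * fst (snd q)) * snd (snd q)))"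
    by (auto simp: vfield_of_apply)
  show ?thesis
    unfolding eq by (rule derivative_eq_intros refl)+ (auto simp: algebra_simps fun_eq_iff power2_eq_square)
qed

lemma lie_bracket_vfield_of: "lie_bracket (vfield_of v) (vfield_of w) = vfield_of (bracket v w)"
proof -
  obtain a b c g p i where v: "v = (a, b, c, g, p, i)" by (metis surj_pair)
  obtain a' b' c' g' p' i' where w: "w = (a', b', c', g', p', i')" by (metis surj_pair)
  have "lie_bracket (vfield_of v) (vfield_of w) (t, x, u) = vfield_of (bracket v w) (t, x, u)" for t x u
    unfolding lie_bracket_def v w
      frechet_derivative_at[OF vfield_of_has_derivative, symmetric]
    by (simp add: vfield_of_apply) (simp add: field_simps power2_eq_square)
  then show ?thesis by auto
qed

text \<open>\<open>heis\<close> is the action of \<open>x \<mapsto> x + kt + m\<close>, and \<open>sl2\<close> that of the projective maps of \<open>t\<close>.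
  The scaling of \<open>u\<close> by \<open>\<sigma>\<close> acts trivially.\<close>

fun heis :: "real \<Rightarrow> real \<Rightarrow> coords \<Rightarrow> coords" where
  "heis k m (a, b, c, g, p, i) = (a, b, c, g + b * k - c * m, p + a * k - b * m,
     i + g * m / 2 - p * k / 2 - a * k\<^sup>2 / 4 + b * k * m / 2 - c * m\<^sup>2 / 4)"

fun sl2 :: "real \<Rightarrow> real \<Rightarrow> real \<Rightarrow> real \<Rightarrow> coords \<Rightarrow> coords" where
  "sl2 \<alpha> \<beta> \<gamma> \<delta> (a, b, c, g, p, i) =
    (a * \<alpha>\<^sup>2 - 2 * b * \<alpha> * \<beta> + c * \<beta>\<^sup>2, b * (\<alpha> * \<delta> + \<beta> * \<gamma>) - a * \<alpha> * \<gamma> - c * \<beta> * \<delta>,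
     a * \<gamma>\<^sup>2 - 2 * b * \<gamma> * \<delta> + c * \<delta>\<^sup>2, g * \<delta> - p * \<gamma>, p * \<alpha> - g * \<beta>, i)"

text \<open>The derivative stays hidden behind an existential: the chain rule needs only its value
  on the transformed field, so this fact and its counterpart for \<open>sl2\<close> compose
  directly.\<close>

lemma heis_map_derivative:
  "\<exists>H'. (ess_map 1 0 0 1 k m 1 has_derivative H') (at q) \<and>
     H' (vfield_of v q) = vfield_of (heis k m v) (ess_map 1 0 0 1 k m 1 q)"
proof -
  obtain t x u where q: "q = (t, x, u)" by (metis surj_pair)
  obtain a b c g p i where v: "v = (a, b, c, g, p, i)" by (metis surj_pair)
  define E where "E = exp (- k / 2 * x - k\<^sup>2 / 4 * t)"
  have eq: "ess_map 1 0 0 1 k m 1 = (\<lambda>q. (fst q, fst (snd q) + k * fst q + m,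
      exp (- k / 2 * fst (snd q) - k\<^sup>2 / 4 * fst q) * snd (snd q)))"
    by (auto simp: ess_map_def)
  have "(ess_map 1 0 0 1 k m 1 has_derivative
     (\<lambda>(dt, dx, du). (dt, dx + k * dt, E * (du - (k / 2 * dx + k\<^sup>2 / 4 * dt) * u)))) (at (t, x, u))"
    unfolding eq E_def
    by (rule derivative_eq_intros refl)+ (auto simp: algebra_simps fun_eq_iff power2_eq_square)
  moreover have "ess_map 1 0 0 1 k m 1 (t, x, u) = (t, x + k * t + m, E * u)"
    by (simp add: eq E_def)
  ultimately show ?thesis unfolding q v
    by - (rule exI, rule conjI, assumption, simp add: vfield_of_apply, simp add: field_simps power2_eq_square)
qed

text \<open>The weight sqrt |\<gamma> t + \<delta>| and the Gaussian factor contribute exactly the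
  terms that make the u-component of the image again the one prescribed by the transformed quadratic
  and linear forms.\<close>

lemma sl2_map_derivative:
  assumes det: "\<alpha> * \<delta> - \<beta> * \<gamma> = 1" and q: "q \<in> ess_dom \<gamma> \<delta>"
  shows "\<exists>H'. (ess_map \<alpha> \<beta> \<gamma> \<delta> 0 0 \<sigma> has_derivative H') (at q) \<and>
     H' (vfield_of v q) = vfield_of (sl2 \<alpha> \<beta> \<gamma> \<delta> v) (ess_map \<alpha> \<beta> \<gamma> \<delta> 0 0 \<sigma> q)"
proof -
  obtain t x u where q': "q = (t, x, u)" by (metis surj_pair)
  obtain a b c g p i where v: "v = (a, b, c, g, p, i)" by (metis surj_pair)
  define s where "s = \<gamma> * t + \<delta>"
  \<comment> \<open>The sign of \<gamma> t + \<delta> is locally constant, so near the point the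
    absolute value may be replaced by \<open>e\<close> times its argument; \<open>f\<close> below is
    this differentiable local version of the map.\<close>
  define e where "e = sgn s"
  have s: "s \<noteq> 0" using q by (simp add: q' s_def ess_dom_def)
  have e: "e * s > 0" "e * s = \<bar>s\<bar>" "e \<noteq> 0" using s by (auto simp: e_def sgn_if)
  define E where "E = \<sigma> * sqrt (e * s) * exp (\<gamma> * x\<^sup>2 / (4 * s))"
  define f where "f = (\<lambda>q::point. ((\<alpha> * fst q + \<beta>) / (\<gamma> * fst q + \<delta>), fst (snd q) / (\<gamma> * fst q + \<delta>),
      \<sigma> * sqrt (e * (\<gamma> * fst q + \<delta>)) * exp (\<gamma> * (fst (snd q))\<^sup>2 / (4 * (\<gamma> * fst q + \<delta>))) * snd (snd q)))"
  have pos: "0 < e * (\<gamma> * fst (t, x, u) + \<delta>)" and nz: "\<gamma> * fst (t, x, u) + \<delta> \<noteq> 0"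
    "4 * (\<gamma> * fst (t, x, u) + \<delta>) \<noteq> 0"
    using e s by (auto simp: s_def)
  define r where "r = sqrt (e * s)"
  have r: "r * r = e * s" "r \<noteq> 0" using e by (auto simp: r_def)
  have r': "sqrt (e * (\<gamma> * t + \<delta>)) = r" by (simp add: r_def s_def)
  \<comment> \<open>Numerator in the derivative of the Moebius map; the determinant condition makes
    it 1, whence dt / s^2.\<close>
  have num: "\<alpha> * s - \<gamma> * (\<alpha> * t + \<beta>) = 1" using det by (simp add: s_def algebra_simps)
  have ir: "e * y * inverse r = r / s * y" for y using r s e by (simp add: field_simps)
  have "(f has_derivative
     (\<lambda>(dt, dx, du). (dt / s\<^sup>2, dx / s - \<gamma> * x * dt / s\<^sup>2,
       E * (du + (\<gamma> * dt / (2 * s) + \<gamma> * x * dx / (2 * s) - \<gamma>\<^sup>2 * x\<^sup>2 * dt / (4 * s\<^sup>2)) * u)))) (at (t, x, u))"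
    unfolding f_def
    apply (rule derivative_eq_intros refl pos nz)+
    apply (simp add: fun_eq_iff r' E_def flip: r_def s_def)
    apply (intro allI conjI)
    subgoal for dt using num s by (simp add: field_simps power2_eq_square) algebra
    subgoal by (simp add: field_simps power2_eq_square)
    subgoal for dt dx du unfolding ir using s by (simp add: field_simps power2_eq_square)
    done
  moreover have "eventually (\<lambda>q. f q = ess_map \<alpha> \<beta> \<gamma> \<delta> 0 0 \<sigma> q) (nhds (t, x, u))"
  proof -
    have "eventually (\<lambda>q. e * (\<gamma> * fst q + \<delta>) > 0) (nhds (t, x, u))"
      using pos by (intro order_tendstoD(1)[of "\<lambda>q. e * (\<gamma> * fst q + \<delta>)" "e * (\<gamma> * fst (t, x, u) + \<delta>)"] tendsto_intros filterlim_ident)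
    then show ?thesis
    proof eventually_elim
      case (elim q)
      have "e * (\<gamma> * fst q + \<delta>) = \<bar>\<gamma> * fst q + \<delta>\<bar>"
        using elim s by (auto simp: e_def sgn_if split: if_splits)
      then show ?case by (simp add: f_def ess_map_def case_prod_beta)
    qed
  qed
  ultimately have d: "(ess_map \<alpha> \<beta> \<gamma> \<delta> 0 0 \<sigma> has_derivative
     (\<lambda>(dt, dx, du). (dt / s\<^sup>2, dx / s - \<gamma> * x * dt / s\<^sup>2,
       E * (du + (\<gamma> * dt / (2 * s) + \<gamma> * x * dx / (2 * s) - \<gamma>\<^sup>2 * x\<^sup>2 * dt / (4 * s\<^sup>2)) * u)))) (at (t, x, u))"
    by - (rule has_derivative_transform_eventually, assumption,
      auto simp: eventually_at_filter dest: eventually_nhds_x_imp_x elim: eventually_mono)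
  have val: "ess_map \<alpha> \<beta> \<gamma> \<delta> 0 0 \<sigma> (t, x, u) = ((\<alpha> * t + \<beta>) / s, x / s, E * u)"
    using e by (simp add: ess_map_def E_def s_def)
  \<comment> \<open>With R and the new time T treated as indeterminates tied by R * s = 1, the
    transformation rules become polynomial identities modulo the determinant relation.
    \<open>\<tau>\<close> and \<open>\<xi>\<close> are the t- and x-components of the field at the
    point.\<close>
  define R where "R = 1 / s"
  define T where "T = (\<alpha> * t + \<beta>) / s"
  define \<tau> where "\<tau> = a + 2 * b * t + c * t\<^sup>2"
  define \<xi> where "\<xi> = b * x + c * t * x + g * t + p"
  have TR: "R * s = 1" "T = (\<alpha> * t + \<beta>) * R" "s = \<gamma> * t + \<delta>" using s by (auto simp: R_def T_def s_def)
  have rew: "y / s = y * R" "y / s\<^sup>2 = y * R\<^sup>2" "y / (2 * s) = y * R / 2" "y / (4 * s\<^sup>2) = y * R\<^sup>2 / 4"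
    for y by (simp_all add: R_def power_divide)
  define a' where "a' = a * \<alpha>\<^sup>2 - 2 * b * \<alpha> * \<beta> + c * \<beta>\<^sup>2"
  define b' where "b' = b * (\<alpha> * \<delta> + \<beta> * \<gamma>) - a * \<alpha> * \<gamma> - c * \<beta> * \<delta>"
  define c' where "c' = a * \<gamma>\<^sup>2 - 2 * b * \<gamma> * \<delta> + c * \<delta>\<^sup>2"
  define g' where "g' = g * \<delta> - p * \<gamma>"
  define p' where "p' = p * \<alpha> - g * \<beta>"
  note w' = a'_def b'_def c'_def g'_def p'_def
  have w: "sl2 \<alpha> \<beta> \<gamma> \<delta> (a, b, c, g, p, i) = (a', b', c', g', p', i)" by (simp add: w')
  have 1: "\<tau> * R\<^sup>2 = a' + 2 * b' * T + c' * T\<^sup>2"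
    using TR det w' unfolding \<tau>_def by algebra
  have 2: "\<xi> * R - \<gamma> * x * \<tau> * R\<^sup>2 = b' * (x * R) + c' * T * (x * R) + g' * T + p'"
    using TR det w' unfolding \<tau>_def \<xi>_def by algebra
  have "4 * i - 2 * b - c * (x\<^sup>2 + 2 * t) - 2 * g * x + 2 * \<gamma> * \<tau> * R + 2 * \<gamma> * x * \<xi> * R
      - \<gamma>\<^sup>2 * x\<^sup>2 * \<tau> * R\<^sup>2 = 4 * i - 2 * b' - c' * ((x * R)\<^sup>2 + 2 * T) - 2 * g' * (x * R)"
    using TR det w' unfolding \<tau>_def \<xi>_def by algebra
  then have 3: "i - b / 2 - c / 4 * (x\<^sup>2 + 2 * t) - g / 2 * x + (\<gamma> * \<tau> * R / 2 + \<gamma> * x * \<xi> * R / 2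
      - \<gamma>\<^sup>2 * x\<^sup>2 * \<tau> * R\<^sup>2 / 4) = i - b' / 2 - c' / 4 * ((x * R)\<^sup>2 + 2 * T) - g' / 2 * (x * R)"
    by (simp add: field_simps)
  have val': "ess_map \<alpha> \<beta> \<gamma> \<delta> 0 0 \<sigma> (t, x, u) = (T, x * R, E * u)"
    using val by (simp add: T_def R_def)
  have "E * ((i - b / 2 - c / 4 * (x\<^sup>2 + 2 * t) - g / 2 * x) * u + (\<gamma> * \<tau> / (2 * s) + \<gamma> * x * \<xi> / (2 * s)
      - \<gamma>\<^sup>2 * x\<^sup>2 * \<tau> / (4 * s\<^sup>2)) * u) = E * u * (i - b / 2 - c / 4 * (x\<^sup>2 + 2 * t) - g / 2 * x +
      (\<gamma> * \<tau> * R / 2 + \<gamma> * x * \<xi> * R / 2 - \<gamma>\<^sup>2 * x\<^sup>2 * \<tau> * R\<^sup>2 / 4))"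
    unfolding rew by (simp add: algebra_simps)
  then have 4: "E * ((i - b / 2 - c / 4 * (x\<^sup>2 + 2 * t) - g / 2 * x) * u + (\<gamma> * \<tau> / (2 * s) + \<gamma> * x * \<xi> / (2 * s)
      - \<gamma>\<^sup>2 * x\<^sup>2 * \<tau> / (4 * s\<^sup>2)) * u) =
      (i - b' / 2 - c' / 4 * ((x * R)\<^sup>2 + 2 * T) - g' / 2 * (x * R)) * (E * u)"
    unfolding 3 by (simp only: mult_ac)
  have 5: "\<xi> / s - \<gamma> * x * \<tau> / s\<^sup>2 = b' * (x * R) + c' * T * (x * R) + g' * T + p'"
    "\<tau> / s\<^sup>2 = a' + 2 * b' * T + c' * T\<^sup>2"
    using 1 2 by (simp_all add: rew)
  show ?thesis unfolding q' v w
    by (rule exI, rule conjI, rule d)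
      (simp only: val' vfield_of_apply prod.case prod.inject 4 5 flip: \<tau>_def \<xi>_def)
qed

section \<open>Pushforward by a general group element\<close>

definition adj where
  "adj \<alpha> \<beta> \<gamma> \<delta> k m v = sl2 \<alpha> \<beta> \<gamma> \<delta> (heis k m v)"

text \<open>The exponent splits into a \<gamma>-term in the already translated x and a k-term in the
  original x, so the projective factor acts after the translation.\<close>

lemma ess_map_factor:
  "ess_map \<alpha> \<beta> \<gamma> \<delta> k m \<sigma> = ess_map \<alpha> \<beta> \<gamma> \<delta> 0 0 \<sigma> \<circ> ess_map 1 0 0 1 k m 1"
proof (rule ext, clarify)
  fix t x u :: real
  have e: "exp (\<gamma> * (x + k * t + m)\<^sup>2 / (4 * (\<gamma> * t + \<delta>)) - k / 2 * x - k\<^sup>2 / 4 * t) =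
    exp (\<gamma> * (x + k * t + m)\<^sup>2 / (4 * (\<gamma> * t + \<delta>))) * exp (- k / 2 * x - k\<^sup>2 / 4 * t)"
    unfolding exp_add[symmetric] by simp
  show "ess_map \<alpha> \<beta> \<gamma> \<delta> k m \<sigma> (t, x, u) = (ess_map \<alpha> \<beta> \<gamma> \<delta> 0 0 \<sigma> \<circ> ess_map 1 0 0 1 k m 1) (t, x, u)"
    unfolding ess_map_def prod.case e by simp
qed

lemma frechet_derivative_ess_map:
  assumes det: "\<alpha> * \<delta> - \<beta> * \<gamma> = 1" and q: "q \<in> ess_dom \<gamma> \<delta>"
  shows "frechet_derivative (ess_map \<alpha> \<beta> \<gamma> \<delta> k m \<sigma>) (at q) (vfield_of v q) =
    vfield_of (adj \<alpha> \<beta> \<gamma> \<delta> k m v) (ess_map \<alpha> \<beta> \<gamma> \<delta> k m \<sigma> q)"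
proof -
  let ?H = "ess_map 1 0 0 1 k m 1" and ?S = "ess_map \<alpha> \<beta> \<gamma> \<delta> 0 0 \<sigma>"
  obtain H' where H': "(?H has_derivative H') (at q)"
    "H' (vfield_of v q) = vfield_of (heis k m v) (?H q)"
    using heis_map_derivative by blast
  \<comment> \<open>The translation fixes t, so it preserves the domain of the projective
    factor.\<close>
  have "?H q \<in> ess_dom \<gamma> \<delta>" using q by (auto simp: ess_dom_def ess_map_def)
  from sl2_map_derivative[OF det this]
  obtain S' where S': "(?S has_derivative S') (at (?H q))"
    "S' (vfield_of (heis k m v) (?H q)) = vfield_of (adj \<alpha> \<beta> \<gamma> \<delta> k m v) (?S (?H q))"
    unfolding adj_def by blast
  have "frechet_derivative (ess_map \<alpha> \<beta> \<gamma> \<delta> k m \<sigma>) (at q) = S' \<circ> H'"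
    unfolding ess_map_factor[of \<alpha> \<beta> \<gamma> \<delta> k m]
    by (rule frechet_derivative_at[symmetric, OF diff_chain_at[OF H'(1) S'(1)]])
  then show ?thesis by (simp add: H' S' ess_map_factor[of \<alpha> \<beta> \<gamma> \<delta> k m])
qed

lemma ess_map_image:
  assumes det: "\<alpha> * \<delta> - \<beta> * \<gamma> = 1" and "\<sigma> \<noteq> 0" and "\<alpha> - \<gamma> * t \<noteq> 0"
  shows "(t, x, u) \<in> ess_map \<alpha> \<beta> \<gamma> \<delta> k m \<sigma> ` ess_dom \<gamma> \<delta>"
proof
  \<comment> \<open>The inverse Moebius map gives t' = (\<delta> t - \<beta>) / (\<alpha> - \<gamma>
    t), and there \<gamma> t' + \<delta> equals 1 / (\<alpha> - \<gamma> t) by the determinant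
    condition. The factor \<open>E\<close> of u is nonzero, so u can be divided by it.\<close>
  define s where "s = 1 / (\<alpha> - \<gamma> * t)"
  define t' where "t' = (\<delta> * t - \<beta>) * s"
  define x' where "x' = x * s - k * t' - m"
  define E where "E = \<sigma> * sqrt \<bar>s\<bar> * exp (\<gamma> * (x * s)\<^sup>2 / (4 * s) - k / 2 * x' - k\<^sup>2 / 4 * t')"
  have s: "s \<noteq> 0" "s * (\<alpha> - \<gamma> * t) = 1" using assms by (auto simp: s_def)
  have s': "\<gamma> * t' + \<delta> = s" unfolding t'_def using det s(2) by algebra
  have t: "\<alpha> * t' + \<beta> = t * s" unfolding t'_def using det s(2) by algebra
  have "E \<noteq> 0" using s assms by (simp add: E_def)
  moreover have "x' + k * t' + m = x * s" by (simp add: x'_def)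
  ultimately show "(t, x, u) = ess_map \<alpha> \<beta> \<gamma> \<delta> k m \<sigma> (t', x', u / E)"
    using s(1) assms(2) unfolding ess_map_def prod.case s' t by (simp add: E_def)
  show "(t', x', u / E) \<in> ess_dom \<gamma> \<delta>" using s s' by (simp add: ess_dom_def)
qed

text \<open>Polynomial components are fixed by their values at three times off the excluded plane; x
  = 0 and u = 1 suffice. This makes equality of restricted fields equivalent to equality of
  coordinates.\<close>

lemma vfield_of_eqI:
  assumes nz: "(\<alpha>, \<gamma>) \<noteq> (0, 0)"
    and eq: "\<And>t x u. \<alpha> - \<gamma> * t \<noteq> 0 \<Longrightarrow> vfield_of v (t, x, u) = vfield_of w (t, x, u)"
  shows "v = w"
proof -
  obtain a b c g p i where vw: "v - w = (a, b, c, g, p, i)" by (cases "v - w")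
  have z: "vfield_of (a, b, c, g, p, i) (t, x, u) = 0" if "\<alpha> - \<gamma> * t \<noteq> 0" for t x u
    unfolding vw[symmetric] linear_diff[OF linear_vfield_of] using eq[OF that, of x u] by simp
  obtain r where r: "\<alpha> - \<gamma> * r \<noteq> 0" "\<alpha> - \<gamma> * (r + 1) \<noteq> 0" "\<alpha> - \<gamma> * (r + 2) \<noteq> 0"
  proof (cases "\<gamma> = 0")
    case False
    \<comment> \<open>The three sample times lie beyond the excluded time \<alpha> /
      \<gamma>.\<close>
    then show ?thesis using that[of "\<alpha> / \<gamma> + 1"] by (simp add: distrib_left)
  next
    case True
    then show ?thesis using that[of 0] nz by simp
  qed
  have abc: "a + 2 * b * s + c * s\<^sup>2 = 0" and gp: "g * s + p = 0" and
    i: "i - b / 2 - c / 4 * (2 * s) = 0" if "\<alpha> - \<gamma> * s \<noteq> 0" for s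
    using z[OF that, of 0 1] by (simp_all add: vfield_of_apply zero_prod_def)
  \<comment> \<open>The second difference isolates the leading coefficient.\<close>
  have "2 * c = (a + 2 * b * (r + 2) + c * (r + 2)\<^sup>2) - 2 * (a + 2 * b * (r + 1) + c * (r + 1)\<^sup>2)
      + (a + 2 * b * r + c * r\<^sup>2)"
    by (simp add: power2_eq_square algebra_simps)
  then have "c = 0" using abc[OF r(1)] abc[OF r(2)] abc[OF r(3)] by simp
  moreover from this have "b = 0" using abc[OF r(1)] abc[OF r(2)] by (simp add: algebra_simps)
  moreover from calculation have "a = 0" using abc[OF r(1)] by simp
  moreover have "g = 0" using gp[OF r(1)] gp[OF r(2)] by (simp add: algebra_simps)
  moreover from this have "p = 0" using gp[OF r(1)] by simp
  moreover from calculation have "i = 0" using i[OF r(1)] by simp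
  ultimately have "v - w = 0" unfolding vw by (simp add: zero_prod_def)
  then show ?thesis by simp
qed

lemma inj_vfield_of: "inj vfield_of"
  by (rule injI, rule vfield_of_eqI[of 1 0]) auto

section \<open>Equivalence as conjugacy in coordinates\<close>

definition conjugate :: "coords set \<Rightarrow> coords set \<Rightarrow> bool" where
  "conjugate S T \<longleftrightarrow> (\<exists>\<alpha> \<beta> \<gamma> \<delta> k m. \<alpha> * \<delta> - \<beta> * \<gamma> = 1 \<and> adj \<alpha> \<beta> \<gamma> \<delta> k m ` S = T)"

lemma pushforward_vfield_of:
  assumes det: "\<alpha> * \<delta> - \<beta> * \<gamma> = 1" and "\<sigma> \<noteq> 0"
  shows "pushforward (ess_dom \<gamma> \<delta>) (ess_map \<alpha> \<beta> \<gamma> \<delta> k m \<sigma>) (vfield_of v) =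
    restrict (vfield_of (adj \<alpha> \<beta> \<gamma> \<delta> k m v)) (ess_map \<alpha> \<beta> \<gamma> \<delta> k m \<sigma> ` ess_dom \<gamma> \<delta>)"
  unfolding pushforward_def
proof (rule restrict_ext)
  fix q assume q: "q \<in> ess_map \<alpha> \<beta> \<gamma> \<delta> k m \<sigma> ` ess_dom \<gamma> \<delta>"
  show "frechet_derivative (ess_map \<alpha> \<beta> \<gamma> \<delta> k m \<sigma>)
      (at (inv_into (ess_dom \<gamma> \<delta>) (ess_map \<alpha> \<beta> \<gamma> \<delta> k m \<sigma>) q))
      (vfield_of v (inv_into (ess_dom \<gamma> \<delta>) (ess_map \<alpha> \<beta> \<gamma> \<delta> k m \<sigma>) q)) =
    vfield_of (adj \<alpha> \<beta> \<gamma> \<delta> k m v) q"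
    using frechet_derivative_ess_map[OF det inv_into_into[OF q]] f_inv_into_f[OF q] by simp
qed

lemma inj_restrict_vfield_of:
  assumes det: "\<alpha> * \<delta> - \<beta> * \<gamma> = 1" and "\<sigma> \<noteq> 0"
  shows "inj (\<lambda>v. restrict (vfield_of v) (ess_map \<alpha> \<beta> \<gamma> \<delta> k m \<sigma> ` ess_dom \<gamma> \<delta>))"
proof (rule injI, rule vfield_of_eqI[of \<alpha> \<gamma>])
  show "(\<alpha>, \<gamma>) \<noteq> (0, 0)" using det by auto
qed (metis ess_map_image[OF assms] restrict_apply')

text \<open>Both sides of the pushforward equation are images of coordinate sets under one injective
  map, from a tuple to its field restricted to the image, and this map can be cancelled.\<close>

lemma ess_equivalent_iff_conjugate:
  "ess_equivalent (vfield_of ` S) (vfield_of ` T) \<longleftrightarrow> conjugate S T"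
proof -
  have "pushforward (ess_dom \<gamma> \<delta>) (ess_map \<alpha> \<beta> \<gamma> \<delta> k m \<sigma>) ` vfield_of ` S =
      (\<lambda>Y. restrict Y (ess_map \<alpha> \<beta> \<gamma> \<delta> k m \<sigma> ` ess_dom \<gamma> \<delta>)) ` vfield_of ` T \<longleftrightarrow>
      adj \<alpha> \<beta> \<gamma> \<delta> k m ` S = T"
    if "\<alpha> * \<delta> - \<beta> * \<gamma> = 1" "\<sigma> \<noteq> 0" for \<alpha> \<beta> \<gamma> \<delta> k m \<sigma>
    using inj_image_eq_iff[OF inj_restrict_vfield_of[OF that, where k = k and m = m],
        of "adj \<alpha> \<beta> \<gamma> \<delta> k m ` S" T]
    by (simp add: image_image pushforward_vfield_of[OF that])
  \<comment> \<open>Conjugacy carries no scale of u; this supplies \<sigma> = 1 when a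
    transformation has to be produced.\<close>
  moreover have "(1::real) \<noteq> 0" by simp
  ultimately show ?thesis
    unfolding ess_equivalent_def G_ess_def conjugate_def Bex_def split_paired_Ex prod.case mem_Collect_eq prod.inject
    by metis
qed

section \<open>Automorphism property and composition law\<close>

lemma linear_adj: "linear (adj \<alpha> \<beta> \<gamma> \<delta> k m)"
  by (rule linearI) (auto simp: adj_def algebra_simps power2_eq_square add_divide_distrib)

lemma bracket_heis: "bracket (heis k m v) (heis k m w) = heis k m (bracket v w)"
  by (cases v; cases w) (simp add: field_simps power2_eq_square)

lemma bracket_sl2:
  assumes "\<alpha> * \<delta> - \<beta> * \<gamma> = 1"
  shows "bracket (sl2 \<alpha> \<beta> \<gamma> \<delta> v) (sl2 \<alpha> \<beta> \<gamma> \<delta> w) = sl2 \<alpha> \<beta> \<gamma> \<delta> (bracket v w)"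
proof -
  obtain a b c g p i where v: "v = (a, b, c, g, p, i)" by (metis surj_pair)
  obtain a' b' c' g' p' i' where w: "w = (a', b', c', g', p', i')" by (metis surj_pair)
  \<comment> \<open>The symplectic form is invariant under determinant one, which settles the
    central entry.\<close>
  have "(g * \<delta> - p * \<gamma>) * (p' * \<alpha> - g' * \<beta>) - (p * \<alpha> - g * \<beta>) * (g' * \<delta> - p' * \<gamma>) = g * p' - p * g'"
    using assms by algebra
  then show ?thesis
    unfolding v w bracket.simps sl2.simps prod.inject using assms
    by (intro conjI; (simp only:)?; algebra)
qed

lemma bracket_adj:
  assumes "\<alpha> * \<delta> - \<beta> * \<gamma> = 1"
  shows "bracket (adj \<alpha> \<beta> \<gamma> \<delta> k m v) (adj \<alpha> \<beta> \<gamma> \<delta> k m w) = adj \<alpha> \<beta> \<gamma> \<delta> k m (bracket v w)"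
  by (simp add: adj_def bracket_heis bracket_sl2[OF assms])

text \<open>The centre of the Heisenberg group acts trivially, so translations simply add.\<close>

lemma heis_heis: "heis k m (heis k' m' v) = heis (k' + k) (m' + m) v"
  by (cases v) (simp add: field_simps power2_eq_square)

lemma sl2_sl2: "sl2 \<alpha> \<beta> \<gamma> \<delta> (sl2 \<alpha>' \<beta>' \<gamma>' \<delta>' v) =
   sl2 (\<alpha> * \<alpha>' + \<beta> * \<gamma>') (\<alpha> * \<beta>' + \<beta> * \<delta>') (\<gamma> * \<alpha>' + \<delta> * \<gamma>') (\<gamma> * \<beta>' + \<delta> * \<delta>') v"
  by (cases v) (simp add: algebra_simps power2_eq_square)

text \<open>Normality of the Heisenberg part: moving a translation past a matrix multiplies the row
  vector (k, m) by that matrix.\<close>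

lemma heis_sl2:
  "heis k m (sl2 \<alpha> \<beta> \<gamma> \<delta> v) = sl2 \<alpha> \<beta> \<gamma> \<delta> (heis (k * \<alpha> + m * \<gamma>) (k * \<beta> + m * \<delta>) v)"
  by (cases v) (simp add: algebra_simps power2_eq_square add_divide_distrib diff_divide_distrib)

text \<open>Composition is carried out on linear maps rather than on partially defined point
  transformations.\<close>

lemma adj_adj:
 "adj \<alpha> \<beta> \<gamma> \<delta> k m (adj \<alpha>' \<beta>' \<gamma>' \<delta>' k' m' v) =
   adj (\<alpha> * \<alpha>' + \<beta> * \<gamma>') (\<alpha> * \<beta>' + \<beta> * \<delta>') (\<gamma> * \<alpha>' + \<delta> * \<gamma>') (\<gamma> * \<beta>' + \<delta> * \<delta>')
     (k' + (k * \<alpha>' + m * \<gamma>')) (m' + (k * \<beta>' + m * \<delta>')) v"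
  by (simp add: adj_def heis_sl2 sl2_sl2 heis_heis)

section \<open>The listed subalgebras in coordinates\<close>

fun coord_basis :: "label \<Rightarrow> coords set" where
  "coord_basis S1_1 = {(1,0,0,1,0,0)}"
| "coord_basis (S1_2 \<delta>) = {(1,0,0,0,0,\<delta>)}"
| "coord_basis (S1_3 \<mu>) = {(0,1,0,0,0,\<mu>)}"
| "coord_basis (S1_4 \<nu>) = {(1,0,1,0,0,\<nu>)}"
| "coord_basis S1_5 = {(0,0,0,0,1,0)}"
| "coord_basis S1_6 = {(0,0,0,0,0,1)}"
| "coord_basis (S2_1 \<nu>) = {(1,0,0,0,0,0), (0,1,0,0,0,\<nu>)}"
| "coord_basis S2_2 = {(1,0,0,1,0,0), (0,0,0,0,0,1)}"
| "coord_basis (S2_3 \<delta>) = {(1,0,0,0,0,\<delta>), (0,0,0,0,1,0)}"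
| "coord_basis S2_4 = {(1,0,0,0,0,0), (0,0,0,0,0,1)}"
| "coord_basis (S2_5 \<nu>) = {(0,1,0,0,0,\<nu>), (0,0,0,0,1,0)}"
| "coord_basis S2_6 = {(0,1,0,0,0,0), (0,0,0,0,0,1)}"
| "coord_basis S2_7 = {(1,0,1,0,0,0), (0,0,0,0,0,1)}"
| "coord_basis S2_8 = {(0,0,0,0,1,0), (0,0,0,0,0,1)}"
| "coord_basis S3_1 = {(1,0,0,0,0,0), (0,1,0,0,0,0), (0,0,1,0,0,0)}"
| "coord_basis (S3_2 \<nu>) = {(1,0,0,0,0,0), (0,1,0,0,0,\<nu>), (0,0,0,0,1,0)}"
| "coord_basis S3_3 = {(1,0,0,0,0,0), (0,1,0,0,0,0), (0,0,0,0,0,1)}"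
| "coord_basis S3_4 = {(1,0,0,1,0,0), (0,0,0,0,1,0), (0,0,0,0,0,1)}"
| "coord_basis S3_5 = {(1,0,0,0,0,0), (0,0,0,0,1,0), (0,0,0,0,0,1)}"
| "coord_basis S3_6 = {(0,1,0,0,0,0), (0,0,0,0,1,0), (0,0,0,0,0,1)}"
| "coord_basis S3_7 = {(0,0,0,1,0,0), (0,0,0,0,1,0), (0,0,0,0,0,1)}"
| "coord_basis S4_1 = {(1,0,0,0,0,0), (0,1,0,0,0,0), (0,0,1,0,0,0), (0,0,0,0,0,1)}"
| "coord_basis S4_2 = {(1,0,0,0,0,0), (0,1,0,0,0,0), (0,0,0,0,1,0), (0,0,0,0,0,1)}"
| "coord_basis S4_3 = {(1,0,0,0,0,0), (0,0,0,1,0,0), (0,0,0,0,1,0), (0,0,0,0,0,1)}"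
| "coord_basis S4_4 = {(0,1,0,0,0,0), (0,0,0,1,0,0), (0,0,0,0,1,0), (0,0,0,0,0,1)}"
| "coord_basis S4_5 = {(1,0,1,0,0,0), (0,0,0,1,0,0), (0,0,0,0,1,0), (0,0,0,0,0,1)}"
| "coord_basis S5_1 = {(1,0,0,0,0,0), (0,1,0,0,0,0), (0,0,0,1,0,0), (0,0,0,0,1,0), (0,0,0,0,0,1)}"

text \<open>A dual description of the spans of \<open>coord_basis\<close>: generators show that a
  listed subalgebra lies in S, equations show that S lies in it.\<close>

fun coord_eqs :: "label \<Rightarrow> coords \<Rightarrow> bool" where
  "coord_eqs S1_1 (a,b,c,g,p,i) \<longleftrightarrow> b = 0 \<and> c = 0 \<and> g = a \<and> p = 0 \<and> i = 0"
| "coord_eqs (S1_2 \<delta>) (a,b,c,g,p,i) \<longleftrightarrow> b = 0 \<and> c = 0 \<and> g = 0 \<and> p = 0 \<and> i = a * \<delta>"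
| "coord_eqs (S1_3 \<mu>) (a,b,c,g,p,i) \<longleftrightarrow> a = 0 \<and> c = 0 \<and> g = 0 \<and> p = 0 \<and> i = b * \<mu>"
| "coord_eqs (S1_4 \<nu>) (a,b,c,g,p,i) \<longleftrightarrow> b = 0 \<and> c = a \<and> g = 0 \<and> p = 0 \<and> i = a * \<nu>"
| "coord_eqs S1_5 (a,b,c,g,p,i) \<longleftrightarrow> a = 0 \<and> b = 0 \<and> c = 0 \<and> g = 0 \<and> i = 0"
| "coord_eqs S1_6 (a,b,c,g,p,i) \<longleftrightarrow> a = 0 \<and> b = 0 \<and> c = 0 \<and> g = 0 \<and> p = 0"
| "coord_eqs (S2_1 \<nu>) (a,b,c,g,p,i) \<longleftrightarrow> c = 0 \<and> g = 0 \<and> p = 0 \<and> i = b * \<nu>"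
| "coord_eqs S2_2 (a,b,c,g,p,i) \<longleftrightarrow> b = 0 \<and> c = 0 \<and> g = a \<and> p = 0"
| "coord_eqs (S2_3 \<delta>) (a,b,c,g,p,i) \<longleftrightarrow> b = 0 \<and> c = 0 \<and> g = 0 \<and> i = a * \<delta>"
| "coord_eqs S2_4 (a,b,c,g,p,i) \<longleftrightarrow> b = 0 \<and> c = 0 \<and> g = 0 \<and> p = 0"
| "coord_eqs (S2_5 \<nu>) (a,b,c,g,p,i) \<longleftrightarrow> a = 0 \<and> c = 0 \<and> g = 0 \<and> i = b * \<nu>"
| "coord_eqs S2_6 (a,b,c,g,p,i) \<longleftrightarrow> a = 0 \<and> c = 0 \<and> g = 0 \<and> p = 0"
| "coord_eqs S2_7 (a,b,c,g,p,i) \<longleftrightarrow> b = 0 \<and> c = a \<and> g = 0 \<and> p = 0"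
| "coord_eqs S2_8 (a,b,c,g,p,i) \<longleftrightarrow> a = 0 \<and> b = 0 \<and> c = 0 \<and> g = 0"
| "coord_eqs S3_1 (a,b,c,g,p,i) \<longleftrightarrow> g = 0 \<and> p = 0 \<and> i = 0"
| "coord_eqs (S3_2 \<nu>) (a,b,c,g,p,i) \<longleftrightarrow> c = 0 \<and> g = 0 \<and> i = b * \<nu>"
| "coord_eqs S3_3 (a,b,c,g,p,i) \<longleftrightarrow> c = 0 \<and> g = 0 \<and> p = 0"
| "coord_eqs S3_4 (a,b,c,g,p,i) \<longleftrightarrow> b = 0 \<and> c = 0 \<and> g = a"
| "coord_eqs S3_5 (a,b,c,g,p,i) \<longleftrightarrow> b = 0 \<and> c = 0 \<and> g = 0"
| "coord_eqs S3_6 (a,b,c,g,p,i) \<longleftrightarrow> a = 0 \<and> c = 0 \<and> g = 0"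
| "coord_eqs S3_7 (a,b,c,g,p,i) \<longleftrightarrow> a = 0 \<and> b = 0 \<and> c = 0"
| "coord_eqs S4_1 (a,b,c,g,p,i) \<longleftrightarrow> g = 0 \<and> p = 0"
| "coord_eqs S4_2 (a,b,c,g,p,i) \<longleftrightarrow> c = 0 \<and> g = 0"
| "coord_eqs S4_3 (a,b,c,g,p,i) \<longleftrightarrow> b = 0 \<and> c = 0"
| "coord_eqs S4_4 (a,b,c,g,p,i) \<longleftrightarrow> a = 0 \<and> c = 0"
| "coord_eqs S4_5 (a,b,c,g,p,i) \<longleftrightarrow> b = 0 \<and> c = a"
| "coord_eqs S5_1 (a,b,c,g,p,i) \<longleftrightarrow> c = 0"

lemma span_coord_basis: "span (coord_basis l) = Collect (coord_eqs l)"
  by (cases l) (auto simp: span_insert span_empty zero_prod_def)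

lemma listed_eq_image: "listed l = vfield_of ` Collect (coord_eqs l)"
proof -
  have "listed l = span (vfield_of ` coord_basis l)"
    by (cases l) (simp_all add: vfield_of_def)
  then show ?thesis
    by (simp add: linear_span_image[OF linear_vfield_of] span_coord_basis)
qed

lemma dim_coord_eqs: "dim (Collect (coord_eqs l)) = listed_dim l"
proof -
  have "dim (coord_basis l) = listed_dim l"
    by (cases l) (simp_all add: dim_insert span_insert zero_prod_def)
  then show ?thesis by (metis dim_span span_coord_basis)
qed

text \<open>Fields form an infinite-dimensional space, so the dimension is carried over along the
  image of a basis.\<close>

lemma dim_vfield_of_image: "dim (vfield_of ` S) = dim S"
proof -
  obtain B where B: "B \<subseteq> S" "independent B" "S \<subseteq> span B" "card B = dim S"
    using basis_exists[of S] by blast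
  have "span S = span B"
    using B by (metis span_eq span_superset subset_trans)
  then have "span (vfield_of ` B) = span (vfield_of ` S)"
    by (simp add: linear_span_image[OF linear_vfield_of])
  moreover have "independent (vfield_of ` B)"
    by (rule linear_independent_injective_image[OF linear_vfield_of B(2)])
      (rule inj_on_subset[OF inj_vfield_of subset_UNIV])
  moreover have "card (vfield_of ` B) = card B"
    by (rule card_image) (rule inj_on_subset[OF inj_vfield_of subset_UNIV])
  ultimately show ?thesis
    using dim_eq_card B(4) by metis
qed

lemma g_ess_eq_range: "g_ess = range vfield_of"
proof -
  let ?B = "{(1,0,0,0,0,0), (0,1,0,0,0,0), (0,0,1,0,0,0), (0,0,0,1,0,0), (0,0,0,0,1,0), (0,0,0,0,0,1)} :: coords set"
  have "g_ess = span (vfield_of ` ?B)" by (simp add: g_ess_def vfield_of_def)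
  moreover have "span ?B = UNIV" by (auto simp: span_insert zero_prod_def)
  ultimately show ?thesis by (simp only: linear_span_image[OF linear_vfield_of])
qed

lemma subspace_coord_eqs: "subspace (Collect (coord_eqs l))"
  by (simp flip: span_coord_basis)

lemma coord_eqs_bracket: "coord_eqs l v \<Longrightarrow> coord_eqs l w \<Longrightarrow> coord_eqs l (bracket v w)"
  by (cases l; cases v; cases w) (auto simp: algebra_simps)

definition coord_subalgebra :: "coords set \<Rightarrow> bool" where
  "coord_subalgebra S \<longleftrightarrow> subspace S \<and> (\<forall>v\<in>S. \<forall>w\<in>S. bracket v w \<in> S)"

lemma lie_subalgebra_image: "lie_subalgebra (vfield_of ` S) g_ess \<longleftrightarrow> coord_subalgebra S"
proof -
  have "subspace (vfield_of ` S) \<longleftrightarrow> subspace S"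
  proof
    assume *: "subspace (vfield_of ` S)"
    have "vfield_of -` (vfield_of ` S) = S" by (rule inj_vimage_image_eq[OF inj_vfield_of])
    then show "subspace S" using linear_subspace_vimage[OF linear_vfield_of *] by simp
  qed (rule linear_subspace_image[OF linear_vfield_of])
  then show ?thesis
    by (auto simp: lie_subalgebra_def coord_subalgebra_def g_ess_eq_range lie_bracket_vfield_of
        inj_image_mem_iff[OF inj_vfield_of])
qed

lemma vfield_of_zero: "vfield_of 0 = 0"
  by (rule linear_0[OF linear_vfield_of])

text \<open>Properness is a dimension count: 0 and 6 are not among the listed dimensions.\<close>

lemma proper_nonzero_subalgebra_listed: "proper_nonzero_subalgebra (listed l)"
proof -
  have d: "dim (listed l) = listed_dim l"
    unfolding listed_eq_image dim_vfield_of_image dim_coord_eqs ..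
  have "dim g_ess = 6"
    unfolding g_ess_eq_range dim_vfield_of_image by simp
  moreover have "dim ({0} :: vfield set) = 0"
    using dim_vfield_of_image[of "{0}"] unfolding image_insert image_empty vfield_of_zero by simp
  moreover have "listed_dim l \<noteq> 0 \<and> listed_dim l \<noteq> 6"
    by (cases l) auto
  ultimately have "listed l \<noteq> {0}" "listed l \<noteq> g_ess"
    using d by metis+
  moreover have "lie_subalgebra (listed l) g_ess"
    unfolding listed_eq_image lie_subalgebra_image
    by (simp add: coord_subalgebra_def subspace_coord_eqs coord_eqs_bracket)
  ultimately show ?thesis by (simp add: proper_nonzero_subalgebra_def)
qed

section \<open>Normal forms of subalgebras\<close>

lemma coord_subalgebra_adj:
  assumes "\<alpha> * \<delta> - \<beta> * \<gamma> = 1" "coord_subalgebra S"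
  shows "coord_subalgebra (adj \<alpha> \<beta> \<gamma> \<delta> k m ` S)"
  using assms unfolding coord_subalgebra_def
  by (auto simp: bracket_adj linear_subspace_image[OF linear_adj])

definition classified :: "coords set \<Rightarrow> bool" where
  "classified S \<longleftrightarrow> (\<exists>l. admissible l \<and> conjugate S (Collect (coord_eqs l)))"

text \<open>Licence to normalise: it suffices to classify any convenient conjugate, because the two
  group elements compose.\<close>

lemma classified_adj:
  assumes det: "\<alpha> * \<delta> - \<beta> * \<gamma> = 1" and "classified (adj \<alpha> \<beta> \<gamma> \<delta> k m ` S)"
  shows "classified S"
proof -
  obtain l \<alpha>' \<beta>' \<gamma>' \<delta>' k' m' where l: "admissible l" and det': "\<alpha>' * \<delta>' - \<beta>' * \<gamma>' = 1"
    and eq: "adj \<alpha>' \<beta>' \<gamma>' \<delta>' k' m' ` adj \<alpha> \<beta> \<gamma> \<delta> k m ` S = Collect (coord_eqs l)"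
    using assms(2) by (auto simp: classified_def conjugate_def)
  have "(\<alpha>' * \<alpha> + \<beta>' * \<gamma>) * (\<gamma>' * \<beta> + \<delta>' * \<delta>) - (\<alpha>' * \<beta> + \<beta>' * \<delta>) * (\<gamma>' * \<alpha> + \<delta>' * \<gamma>) =
      (\<alpha>' * \<delta>' - \<beta>' * \<gamma>') * (\<alpha> * \<delta> - \<beta> * \<gamma>)"
    by (simp add: algebra_simps)
  then have "(\<alpha>' * \<alpha> + \<beta>' * \<gamma>) * (\<gamma>' * \<beta> + \<delta>' * \<delta>) - (\<alpha>' * \<beta> + \<beta>' * \<delta>) * (\<gamma>' * \<alpha> + \<delta>' * \<gamma>) = 1"
    unfolding det det' by simp
  then have "conjugate S (Collect (coord_eqs l))"
    using eq unfolding conjugate_def image_image adj_adj by blast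
  then show ?thesis using l by (auto simp: classified_def)
qed

lemma classifiedI:
  assumes S: "coord_subalgebra S" and l: "admissible l" and "coord_basis l \<subseteq> S"
    and "\<And>v. v \<in> S \<Longrightarrow> coord_eqs l v"
  shows "classified S"
proof -
  have "Collect (coord_eqs l) \<subseteq> S"
    unfolding span_coord_basis[symmetric] using S assms(3)
    by (simp add: span_minimal coord_subalgebra_def)
  then have "S = Collect (coord_eqs l)" using assms(4) by auto
  moreover have "adj 1 0 0 1 0 0 ` S = S"
  proof -
    have "adj 1 0 0 1 0 0 v = v" for v by (cases v) (simp add: adj_def)
    then show ?thesis by simp
  qed
  ultimately have "conjugate S (Collect (coord_eqs l))"
    unfolding conjugate_def by (intro exI[of _ 1] exI[of _ 0] exI[of _ 0] exI[of _ 1] exI[of _ 0] exI[of _ 0]) simp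
  then show ?thesis using l by (auto simp: classified_def)
qed

section \<open>Closure rules for a bracket-closed subspace\<close>

locale coord_subalg =
  fixes S :: "coords set"
  assumes subalg: "coord_subalgebra S"
begin

text \<open>Linear combinations with explicit coefficients, so that the simplifier evaluates the
  resulting tuple; scaling is the case of second coefficient 0.\<close>

lemma comb: "(a, b, c, g, p, i) \<in> S \<Longrightarrow> (a', b', c', g', p', i') \<in> S \<Longrightarrow>
    (r * a + s * a', r * b + s * b', r * c + s * c', r * g + s * g', r * p + s * p', r * i + s * i') \<in> S"
  using subalg subspace_add[of S "r *\<^sub>R (a, b, c, g, p, i)" "s *\<^sub>R (a', b', c', g', p', i')"]
    subspace_scale[of S] by (auto simp: coord_subalgebra_def)

lemma bracket_mem: "v \<in> S \<Longrightarrow> w \<in> S \<Longrightarrow> bracket v w \<in> S"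
  using subalg by (simp add: coord_subalgebra_def)

lemma unit:
  "(a, 0, 0, 0, 0, 0) \<in> S \<Longrightarrow> a \<noteq> 0 \<Longrightarrow> (1, 0, 0, 0, 0, 0) \<in> S"
  "(0, b, 0, 0, 0, 0) \<in> S \<Longrightarrow> b \<noteq> 0 \<Longrightarrow> (0, 1, 0, 0, 0, 0) \<in> S"
  "(0, 0, c, 0, 0, 0) \<in> S \<Longrightarrow> c \<noteq> 0 \<Longrightarrow> (0, 0, 1, 0, 0, 0) \<in> S"
  "(0, 0, 0, g, 0, 0) \<in> S \<Longrightarrow> g \<noteq> 0 \<Longrightarrow> (0, 0, 0, 1, 0, 0) \<in> S"
  "(0, 0, 0, 0, p, 0) \<in> S \<Longrightarrow> p \<noteq> 0 \<Longrightarrow> (0, 0, 0, 0, 1, 0) \<in> S"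
  "(0, 0, 0, 0, 0, i) \<in> S \<Longrightarrow> i \<noteq> 0 \<Longrightarrow> (0, 0, 0, 0, 0, 1) \<in> S"
  using comb[of a 0 0 0 0 0 a 0 0 0 0 0 "1 / a" 0] comb[of 0 b 0 0 0 0 0 b 0 0 0 0 "1 / b" 0]
    comb[of 0 0 c 0 0 0 0 0 c 0 0 0 "1 / c" 0] comb[of 0 0 0 g 0 0 0 0 0 g 0 0 "1 / g" 0]
    comb[of 0 0 0 0 p 0 0 0 0 0 p 0 "1 / p" 0] comb[of 0 0 0 0 0 i 0 0 0 0 0 i "1 / i" 0]
  by simp_all

lemma center_mem:
  "(0, 0, 0, g, p, i) \<in> S \<Longrightarrow> (0, 0, 0, g', p', i') \<in> S \<Longrightarrow> g * p' - p * g' \<noteq> 0 \<Longrightarrow> (0, 0, 0, 0, 0, 1) \<in> S"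
  using bracket_mem[of "(0, 0, 0, g, p, i)" "(0, 0, 0, g', p', i')"] unit(6)[of "(g * p' - p * g') / 2"] by simp

text \<open>Cramer's rule for two independent linear forms; the leftover central entry is removed
  with I, which their bracket provides.\<close>

lemma heis_mem:
  assumes "(0, 0, 0, g, p, i) \<in> S" "(0, 0, 0, g', p', i') \<in> S" "g * p' - p * g' \<noteq> 0"
  shows "(0, 0, 0, 1, 0, 0) \<in> S" "(0, 0, 0, 0, 1, 0) \<in> S"
proof -
  note I = center_mem[OF assms]
  have "(0, 0, 0, p' * g - p * g', 0, p' * i - p * i') \<in> S"
    using comb[OF assms(1,2), of p' "-p"] by (simp add: algebra_simps)
  from comb[OF this I, of 1 "- (p' * i - p * i')"]
  show "(0, 0, 0, 1, 0, 0) \<in> S" using assms(3) by (intro unit(4)[of "g * p' - p * g'"]) (simp_all add: algebra_simps)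
  have "(0, 0, 0, 0, g * p' - g' * p, g * i' - g' * i) \<in> S"
    using comb[OF assms(1,2), of "-g'" g] by (simp add: algebra_simps)
  from comb[OF this I, of 1 "- (g * i' - g' * i)"]
  show "(0, 0, 0, 0, 1, 0) \<in> S" using assms(3) by (intro unit(5)[of "g * p' - p * g'"]) (simp_all add: algebra_simps)
qed

end

lemma coord_subalg_adj:
  assumes "\<alpha> * \<delta> - \<beta> * \<gamma> = 1" "coord_subalg S"
  shows "coord_subalg (adj \<alpha> \<beta> \<gamma> \<delta> k m ` S)"
  using coord_subalgebra_adj[OF assms(1)] assms(2) by (simp add: coord_subalg_def)

lemma coord_subalg_imp_classified:
  assumes "coord_subalg S" "admissible l" "coord_basis l \<subseteq> S"
    "\<And>a b c g p i. (a, b, c, g, p, i) \<in> S \<Longrightarrow> coord_eqs l (a, b, c, g, p, i)"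
  shows "classified S"
  by (rule classifiedI) (use assms in \<open>auto simp: coord_subalg_def\<close>)

lemma classified_adjI:
  assumes det: "\<alpha> * \<delta> - \<beta> * \<gamma> = 1" and S: "coord_subalg S" and l: "admissible l"
    and basis: "coord_basis l \<subseteq> adj \<alpha> \<beta> \<gamma> \<delta> k m ` S"
    and eqs: "\<And>a b c g p i. (a, b, c, g, p, i) \<in> S \<Longrightarrow> coord_eqs l (adj \<alpha> \<beta> \<gamma> \<delta> k m (a, b, c, g, p, i))"
  shows "classified S"
  by (rule classified_adj[OF det, of k m], rule classifiedI[OF _ l basis])
    (use coord_subalg_adj[OF det S] eqs in \<open>auto simp: coord_subalg_def\<close>)

lemma adj_memI:
  "v \<in> S \<Longrightarrow> adj \<alpha> \<beta> \<gamma> \<delta> k m v = w \<Longrightarrow> w \<in> adj \<alpha> \<beta> \<gamma> \<delta> k m ` S"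
  by blast

section \<open>Subalgebras of the Heisenberg radical\<close>

context coord_subalg
begin

lemmas classifiedI' = coord_subalg_imp_classified[OF coord_subalg_axioms]

lemma classify_translation:
  assumes zero: "\<And>a b c g p i. (a, b, c, g, p, i) \<in> S \<Longrightarrow> a = 0 \<and> b = 0 \<and> c = 0"
    and P: "(0, 0, 0, 0, 1, 0) \<in> S"
  shows "classified S"
proof (cases "\<exists>g p i. (0, 0, 0, g, p, i) \<in> S \<and> g \<noteq> 0")
  case True
  then obtain g p i where v: "(0, 0, 0, g, p, i) \<in> S" "g \<noteq> 0" by blast
  show ?thesis
    by (rule classifiedI'[of S3_7]) (use heis_mem[OF v(1) P] center_mem[OF v(1) P] v(2) P zero in auto)
next
  case False
  then have g: "g = 0" if "(a, b, c, g, p, i) \<in> S" for a b c g p i using zero[OF that] that by auto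
  show ?thesis
  proof (cases "(0, 0, 0, 0, 0, 1) \<in> S")
    case True
    show ?thesis by (rule classifiedI'[of S2_8]) (use P True zero g in auto)
  next
    case False
    have "i = 0" if "(a, b, c, g, p, i) \<in> S" for a b c g p i
      using unit(6)[of i] False comb[OF that P, of 1 "-p"] zero[OF that] g[OF that] by auto
    then show ?thesis by (intro classifiedI'[of S1_5]) (use P zero g in auto)
  qed
qed

lemma classify_heisenberg:
  assumes zero: "\<And>a b c g p i. (a, b, c, g, p, i) \<in> S \<Longrightarrow> a = 0 \<and> b = 0 \<and> c = 0"
    and nz: "S \<noteq> {0}"
  shows "classified S"
proof (cases "\<exists>g p i. (0, 0, 0, g, p, i) \<in> S \<and> (g \<noteq> 0 \<or> p \<noteq> 0)")
  case True
  then obtain g p i where v: "(0, 0, 0, g, p, i) \<in> S" "g \<noteq> 0 \<or> p \<noteq> 0" by blast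
  \<comment> \<open>The matrix with rows r (p, -g) and (g, p) has determinant 1 and carries the
    linear part (g, p) to (0, 1), that is, to P^x.\<close>
  define r where "r = 1 / (g\<^sup>2 + p\<^sup>2)"
  have "r * (g\<^sup>2 + p\<^sup>2) = 1" using v by (simp add: r_def sum_power2_eq_zero_iff)
  then have r: "r * p * p + r * g * g = 1" by (simp add: algebra_simps power2_eq_square)
  have det: "(r * p) * p - (- r * g) * g = 1" using r by simp
  \<comment> \<open>A translation changes the central entry by (g m - p k) / 2; this choice,
    proportional to (p, -g), cancels i.\<close>
  define k where "k = 2 * (i * r * p)"
  define m where "m = - 2 * (i * r * g)"
  have "i + g * m / 2 - p * k / 2 = i * (1 - (r * p * p + r * g * g))"
    by (simp add: k_def m_def algebra_simps)
  then have km: "i + g * m / 2 - p * k / 2 = 0" unfolding r by simp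
  interpret T: coord_subalg "adj (r * p) (- r * g) g p k m ` S"
    by (rule coord_subalg_adj[OF det coord_subalg_axioms])
  have "adj (r * p) (- r * g) g p k m (0, 0, 0, g, p, i) = (0, 0, 0, 0, 1, 0)"
  proof -
    have "p * (r * p) - g * (- r * g) = 1" using r by (simp add: mult_ac)
    then show ?thesis using km by (simp add: adj_def)
  qed
  then have P: "(0, 0, 0, 0, 1, 0) \<in> adj (r * p) (- r * g) g p k m ` S"
    by (rule adj_memI[OF v(1)])
  show ?thesis
    by (rule classified_adj[OF det], rule T.classify_translation[OF _ P])
      (auto simp: adj_def dest: zero)
next
  case False
  then have gp: "g = 0" "p = 0" if "(a, b, c, g, p, i) \<in> S" for a b c g p i using zero[OF that] that by auto
  have "0 \<in> S" using subalg by (simp add: coord_subalgebra_def subspace_0)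
  then obtain v where "v \<in> S" "v \<noteq> 0" using nz by blast
  moreover obtain a b c g p i where v: "v = (a, b, c, g, p, i)" by (cases v)
  ultimately have abc: "(a, b, c, g, p, i) \<in> S" and "(a, b, c, g, p, i) \<noteq> 0" by simp_all
  with zero[OF abc] gp[OF abc] have "(0, 0, 0, 0, 0, 1) \<in> S"
    using unit(6)[of i] by (simp add: zero_prod_def)
  then show ?thesis by (intro classifiedI'[of S1_6]) (use zero gp in auto)
qed

end

section \<open>Parabolic case: projection spanned by P^t\<close>

text \<open>Rescaling acts on the ratio of the I- and P^t-coefficients through positive squares
  only, so that ratio reduces to its sign.\<close>

lemma exists_square_scale: "\<exists>\<alpha>::real. \<alpha> \<noteq> 0 \<and> sgn j * \<alpha>\<^sup>2 = j"
proof (cases "j = 0")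
  case False
  then show ?thesis by (intro exI[of _ "sqrt \<bar>j\<bar>"]) (simp add: sgn_mult_abs)
qed (auto intro: exI[of _ 1])

context coord_subalg
begin

lemma classify_parabolic_normalized:
  assumes bc: "\<And>a b c g p i. (a, b, c, g, p, i) \<in> S \<Longrightarrow> b = 0 \<and> c = 0"
    and X: "(1, 0, 0, g, 0, i) \<in> S" and gi: "g = 1 \<and> i = 0 \<or> g = 0 \<and> i \<in> {-1, 0, 1}"
  shows "classified S"
proof (cases "\<exists>g p i. (0, 0, 0, g, p, i) \<in> S \<and> g \<noteq> 0")
  case True
  then obtain g' p' i' where n: "(0, 0, 0, g', p', i') \<in> S" "g' \<noteq> 0" by blast
  \<comment> \<open>Bracketing with P^t turns a G^x-component into P^x, so the two radical elements
    have independent linear parts and generate the whole radical.\<close>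
  have "(0, 0, 0, 0, g', g * p' / 2) \<in> S" using bracket_mem[OF X n(1)] by simp
  note GP = heis_mem[OF n(1) this] and I = center_mem[OF n(1) this]
  have G: "(0, 0, 0, 1, 0, 0) \<in> S" and P: "(0, 0, 0, 0, 1, 0) \<in> S" and I: "(0, 0, 0, 0, 0, 1) \<in> S"
    using GP I n(2) by auto
  have "(1, 0, 0, 0, 0, i) \<in> S" using comb[OF X G, of 1 "-g"] by simp
  from comb[OF this I, of 1 "-i"] have "(1, 0, 0, 0, 0, 0) \<in> S" by simp
  then show ?thesis by (intro classifiedI'[of S4_3]) (use G P I bc in auto)
next
  case False
  have g: "g' = a * g" if "(a, b, c, g', p', i') \<in> S" for a b c g' p' i'
  proof -
    have "(0, 0, 0, g' - a * g, p', i' - a * i) \<in> S" using comb[OF that X, of 1 "-a"] bc[OF that] by simp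
    then show ?thesis using False by force
  qed
  show ?thesis
  proof (cases "\<exists>p i. (0, 0, 0, 0, p, i) \<in> S \<and> p \<noteq> 0")
    case True
    then obtain p' i' where n: "(0, 0, 0, 0, p', i') \<in> S" "p' \<noteq> 0" by blast
    define q where "q = i' / p'"
    have n': "(0, 0, 0, 0, 1, q) \<in> S" using comb[OF n(1) n(1), of "1 / p'" 0] n(2) by (simp add: q_def)
    \<comment> \<open>[P^t + G^x, P^x] = I / 2: without I the G^x-term cannot coexist with
      P^x.\<close>
    have Ig: "(0, 0, 0, 0, 0, 1) \<in> S" if "g = 1"
      using bracket_mem[OF X n'] unit(6)[of "g / 2"] that by simp
    show ?thesis
    proof (cases "(0, 0, 0, 0, 0, 1) \<in> S")
      case I: True
      have P: "(0, 0, 0, 0, 1, 0) \<in> S" using comb[OF n' I, of 1 "-q"] by simp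
      have Y: "(1, 0, 0, g, 0, 0) \<in> S" using comb[OF X I, of 1 "-i"] by simp
      consider "g = 1" | "g = 0" using gi by blast
      then show ?thesis
      proof cases
        case 1
        then show ?thesis by (intro classifiedI'[of S3_4]) (use I P Y g bc in auto)
      next
        case 2
        then show ?thesis by (intro classifiedI'[of S3_5]) (use I P Y g bc in auto)
      qed
    next
      case I: False
      then have g0: "g = 0" using Ig gi by auto
      have j: "j = a * i + p * q" if "(a, b, c, g', p, j) \<in> S" for a b c g' p j
        using unit(6)[of "j - a * i - p * q"] I bc[OF that] g[OF that] g0
          comb[OF comb[OF that X, of 1 "-a"] n', of 1 "-p"] by fastforce
      \<comment> \<open>Translation by k = 2q turns P^x + q I into P^x and P^t + i I into P^t + 2q
        P^x + (i - q^2) I. Modulo P^x the sign of i - q^2 is therefore the parameter.\<close>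
      obtain \<alpha> where \<alpha>: "\<alpha> \<noteq> 0" "sgn (i - q\<^sup>2) * \<alpha>\<^sup>2 = i - q\<^sup>2" using exists_square_scale by blast
      have P: "(0, 0, 0, 0, 1, 0) \<in> adj \<alpha> 0 0 (1 / \<alpha>) (2 * q) 0 ` S"
        by (rule adj_memI[OF comb[OF n' n', of "1 / \<alpha>" 0]]) (use \<alpha>(1) in \<open>simp add: adj_def\<close>)
      have "i / \<alpha>\<^sup>2 = sgn (i - q\<^sup>2) + q\<^sup>2 / \<alpha>\<^sup>2"
        using \<alpha> by (simp add: field_simps)
      then have Y: "(1, 0, 0, 0, 0, sgn (i - q\<^sup>2)) \<in> adj \<alpha> 0 0 (1 / \<alpha>) (2 * q) 0 ` S"
        by (intro adj_memI[OF comb[OF X n', of "1 / \<alpha>\<^sup>2" "- 2 * q / \<alpha>\<^sup>2"]])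
          (use \<alpha>(1) g0 in \<open>simp add: adj_def power2_eq_square\<close>)
      have "coord_eqs (S2_3 (sgn (i - q\<^sup>2))) (adj \<alpha> 0 0 (1 / \<alpha>) (2 * q) 0 (a, b, c, g', p, j))"
        if "(a, b, c, g', p, j) \<in> S" for a b c g' p j
      proof -
        have "a * \<alpha>\<^sup>2 * sgn (i - q\<^sup>2) = a * (i - q\<^sup>2)" using arg_cong[OF \<alpha>(2), of "\<lambda>z. a * z"] by (simp only: mult_ac)
        then show ?thesis
          using bc[OF that] g[OF that] g0 j[OF that] by (simp add: adj_def algebra_simps)
      qed
      then show ?thesis
        by (intro classified_adjI[of \<alpha> "1 / \<alpha>" 0 0 S "S2_3 (sgn (i - q\<^sup>2))" "2 * q" 0] coord_subalg_axioms)
          (use \<alpha>(1) P Y in \<open>auto simp: sgn_if\<close>)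
    qed
  next
    case False
    have p: "p' = 0" if "(a, b, c, g', p', i') \<in> S" for a b c g' p' i'
      using comb[OF that X, of 1 "-a"] bc[OF that] g[OF that] False by auto
    show ?thesis
    proof (cases "(0, 0, 0, 0, 0, 1) \<in> S")
      case I: True
      have Y: "(1, 0, 0, g, 0, 0) \<in> S" using comb[OF X I, of 1 "-i"] by simp
      consider "g = 1" | "g = 0" using gi by blast
      then show ?thesis
      proof cases
        case 1
        then show ?thesis by (intro classifiedI'[of S2_2]) (use I Y g p bc in auto)
      next
        case 2
        then show ?thesis by (intro classifiedI'[of S2_4]) (use I Y g p bc in auto)
      qed
    next
      case I: False
      have j: "j = a * i" if "(a, b, c, g', p', j) \<in> S" for a b c g' p' j
        using unit(6)[of "j - a * i"] I comb[OF that X, of 1 "-a"] bc[OF that] g[OF that] p[OF that] by auto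
      from gi show ?thesis
      proof
        assume "g = 1 \<and> i = 0"
        then show ?thesis by (intro classifiedI'[of S1_1]) (use X g p bc j in auto)
      next
        assume "g = 0 \<and> i \<in> {-1, 0, 1}"
        then show ?thesis by (intro classifiedI'[of "S1_2 i"]) (use X g p bc j in auto)
      qed
    qed
  qed
qed

end

text \<open>The diagonal matrix of \<alpha> multiplies P^t by \<alpha>^2 and G^x by 1 / \<alpha>, so
  relative to P^t the coefficient g is divided by \<alpha>^3, and a real cube root brings any g
  \<noteq> 0 to 1. In that case m also removes the central entry; if g = 0, only its sign is
  left.\<close>

lemma parabolic_scale:
  fixes g i q :: real
  obtains \<alpha> m g' i' where "\<alpha> \<noteq> 0" "g = \<alpha>^3 * g'" "i + g * m / 2 + q = \<alpha>\<^sup>2 * i'"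
    "g' = 1 \<and> i' = 0 \<or> g' = 0 \<and> i' \<in> {-1, 0, 1}"
proof (cases "g = 0")
  case True
  obtain \<alpha> where \<alpha>: "\<alpha> \<noteq> 0" "sgn (i + q) * \<alpha>\<^sup>2 = i + q" using exists_square_scale by blast
  have "sgn (i + q) \<in> {-1, 0, 1}" by (simp add: sgn_if)
  then show ?thesis
    by (intro that[of \<alpha> 0 0 "sgn (i + q)"]) (simp_all add: \<alpha> True mult.commute)
next
  case False
  have \<alpha>: "root 3 g ^ 3 = g" by (simp add: odd_real_root_pow)
  show ?thesis
  proof (rule that[of "root 3 g" 1 "- 2 * ((i + q) / g)" 0])
    have *: "g * (- 2 * ((i + q) / g)) / 2 = - (i + q)" using False by simp
    show "i + g * (- 2 * ((i + q) / g)) / 2 + q = (root 3 g)\<^sup>2 * 0"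
      unfolding * by simp
  qed (use \<alpha> False in simp_all)
qed
lemma adj_imageE:
  assumes "v \<in> adj \<alpha> \<beta> \<gamma> \<delta> k m ` S"
  obtains a b c g p i where "(a, b, c, g, p, i) \<in> S" "v = adj \<alpha> \<beta> \<gamma> \<delta> k m (a, b, c, g, p, i)"
proof -
  from assms obtain w where "w \<in> S" "v = adj \<alpha> \<beta> \<gamma> \<delta> k m w" by blast
  then show ?thesis by (cases w) (auto intro: that)
qed

context coord_subalg
begin

lemma classify_parabolic:
  assumes bc: "\<And>a b c g p i. (a, b, c, g, p, i) \<in> S \<Longrightarrow> b = 0 \<and> c = 0"
    and X: "(1, 0, 0, g, p, i) \<in> S"
  shows "classified S"
proof -
  \<comment> \<open>Clearing p requires k = -p, which shifts the central entry by p^2 / 2 - p^2 / 4;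
    this is the summand p^2 / 4.\<close>
  obtain \<alpha> m g' i' where \<alpha>: "\<alpha> \<noteq> 0" and g': "g = \<alpha>^3 * g'" and i': "i + g * m / 2 + p\<^sup>2 / 4 = \<alpha>\<^sup>2 * i'"
    and gi: "g' = 1 \<and> i' = 0 \<or> g' = 0 \<and> i' \<in> {-1, 0, 1}"
    by (rule parabolic_scale)
  have det: "\<alpha> * (1 / \<alpha>) - 0 * 0 = 1" using \<alpha> by simp
  interpret T: coord_subalg "adj \<alpha> 0 0 (1 / \<alpha>) (- p) m ` S"
    by (rule coord_subalg_adj[OF det coord_subalg_axioms])
  have "adj \<alpha> 0 0 (1 / \<alpha>) (- p) m (1, 0, 0, g, p, i) = (\<alpha>\<^sup>2, 0, 0, g / \<alpha>, 0, i + g * m / 2 + p\<^sup>2 / 4)"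
    by (simp add: adj_def) (simp add: power2_eq_square)
  moreover have "g / \<alpha> = \<alpha>\<^sup>2 * g'"
    using \<alpha> g' by (simp add: power3_eq_cube power2_eq_square)
  ultimately have "(\<alpha>\<^sup>2, 0, 0, \<alpha>\<^sup>2 * g', 0, \<alpha>\<^sup>2 * i') \<in> adj \<alpha> 0 0 (1 / \<alpha>) (- p) m ` S"
    using adj_memI[OF X] i' by metis
  from T.comb[OF this this, of "1 / \<alpha>\<^sup>2" 0]
  have "(1, 0, 0, g', 0, i') \<in> adj \<alpha> 0 0 (1 / \<alpha>) (- p) m ` S"
    using \<alpha> by simp
  moreover have "b = 0 \<and> c = 0" if "(a, b, c, g, p', i) \<in> adj \<alpha> 0 0 (1 / \<alpha>) (- p) m ` S" for a b c g p' i
    using that by (rule adj_imageE) (drule bc, simp add: adj_def)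
  ultimately have "classified (adj \<alpha> 0 0 (1 / \<alpha>) (- p) m ` S)"
    using T.classify_parabolic_normalized[OF _ _ gi] by blast
  then show ?thesis by (rule classified_adj[OF det])
qed

section \<open>Hyperbolic case: projection spanned by D\<close>

text \<open>The bracket with D + i I has eigenvalues 1, -1, 0 on G^x, P^x, I. They are distinct, so
  each eigencomponent of a radical element of S lies in S.\<close>

lemma split_weights:
  assumes X: "(0, 1, 0, 0, 0, i) \<in> S" and n: "(0, 0, 0, g, p, j) \<in> S"
  shows "(0, 0, 0, g, 0, 0) \<in> S" "(0, 0, 0, 0, p, 0) \<in> S" "(0, 0, 0, 0, 0, j) \<in> S"
proof -
  have 1: "(0, 0, 0, g, -p, 0) \<in> S" using bracket_mem[OF X n] by simp
  have 2: "(0, 0, 0, g, p, 0) \<in> S" using bracket_mem[OF X 1] by simp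
  show "(0, 0, 0, g, 0, 0) \<in> S" using comb[OF 1 2, of "1/2" "1/2"] by simp
  show "(0, 0, 0, 0, p, 0) \<in> S" using comb[OF 1 2, of "-1/2" "1/2"] by simp
  show "(0, 0, 0, 0, 0, j) \<in> S" using comb[OF n 2, of 1 "-1"] by simp
qed

lemma components_zero:
  assumes X: "(0, 1, 0, 0, 0, i) \<in> S" and n: "(0, 0, 0, g, p, j) \<in> S"
  shows "(0, 0, 0, 1, 0, 0) \<notin> S \<Longrightarrow> g = 0" "(0, 0, 0, 0, 1, 0) \<notin> S \<Longrightarrow> p = 0"
    "(0, 0, 0, 0, 0, 1) \<notin> S \<Longrightarrow> j = 0"
  using split_weights[OF assms] unit(4-6) by blast+

lemma classify_hyperbolic_normalized:
  assumes ac: "\<And>a b c g p i. (a, b, c, g, p, i) \<in> S \<Longrightarrow> a = 0 \<and> c = 0"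
    and X: "(0, 1, 0, 0, 0, i) \<in> S"
  shows "classified S"
proof -
  have N: "(0, 0, 0, g, p, j - b * i) \<in> S" if "(a, b, c, g, p, j) \<in> S" for a b c g p j
    using comb[OF that X, of 1 "-b"] ac[OF that] by simp
  have rest: "(0, 0, 0, 1, 0, 0) \<notin> S \<Longrightarrow> g = 0" "(0, 0, 0, 0, 1, 0) \<notin> S \<Longrightarrow> p = 0"
    "(0, 0, 0, 0, 0, 1) \<notin> S \<Longrightarrow> j = b * i" if "(a, b, c, g, p, j) \<in> S" for a b c g p j
    using components_zero[OF X N[OF that]] by auto
  have D: "(0, 1, 0, 0, 0, 0) \<in> S" if "(0, 0, 0, 0, 0, 1) \<in> S"
    using comb[OF X that, of 1 "-i"] by simp
  \<comment> \<open>The Weyl element exchanges the lines of G^x and P^x and sends D + i I to -(D - i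
    I). It moves a lone G^x to P^x, and makes i nonnegative when S is a line.\<close>
  have weyl: "classified S" if "admissible l" "coord_basis l \<subseteq> adj 0 1 (-1) 0 0 0 ` S"
    "\<And>a b c g p i. (a, b, c, g, p, i) \<in> S \<Longrightarrow> coord_eqs l (c, -b, a, p, -g, i)" for l
    by (rule classified_adjI[of 0 0 1 "-1" S l 0 0]) (use that coord_subalg_axioms in \<open>auto simp: adj_def\<close>)
  have weylX: "(0, 1, 0, 0, 0, -i) \<in> adj 0 1 (-1) 0 0 0 ` S"
    by (rule adj_memI[OF comb[OF X X, of "-1" 0]]) (simp add: adj_def)
  consider (GP) "(0, 0, 0, 1, 0, 0) \<in> S" "(0, 0, 0, 0, 1, 0) \<in> S"
    | (G) "(0, 0, 0, 1, 0, 0) \<in> S" "(0, 0, 0, 0, 1, 0) \<notin> S"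
    | (P) "(0, 0, 0, 1, 0, 0) \<notin> S" "(0, 0, 0, 0, 1, 0) \<in> S"
    | (N) "(0, 0, 0, 1, 0, 0) \<notin> S" "(0, 0, 0, 0, 1, 0) \<notin> S" by blast
  then show ?thesis
  proof cases
    case GP
    have "(0, 0, 0, 0, 0, 1) \<in> S" using center_mem[OF GP] by simp
    then show ?thesis by (intro classifiedI'[of S4_4]) (use GP D ac in auto)
  next
    case G
    have G': "(0, 0, 0, 0, 1, 0) \<in> adj 0 1 (-1) 0 0 0 ` S"
      by (rule adj_memI[OF comb[OF G(1) G(1), of "-1" 0]]) (simp add: adj_def)
    show ?thesis
    proof (cases "(0, 0, 0, 0, 0, 1) \<in> S")
      case True
      have "(0, 0, 0, 0, 0, 1) \<in> adj 0 1 (-1) 0 0 0 ` S"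
        by (rule adj_memI[OF True]) (simp add: adj_def)
      moreover have "(0, 1, 0, 0, 0, 0) \<in> adj 0 1 (-1) 0 0 0 ` S"
        by (rule adj_memI[OF comb[OF D[OF True] D[OF True], of "-1" 0]]) (simp add: adj_def)
      ultimately show ?thesis by (intro weyl[of S3_6]) (use G G' ac rest in auto)
    next
      case False
      show ?thesis by (intro weyl[of "S2_5 (-i)"]) (use False G G' weylX ac rest in auto)
    qed
  next
    case P
    show ?thesis
    proof (cases "(0, 0, 0, 0, 0, 1) \<in> S")
      case True
      show ?thesis by (intro classifiedI'[of S3_6]) (use True P D ac rest in auto)
    next
      case False
      show ?thesis by (intro classifiedI'[of "S2_5 i"]) (use False P X ac rest in auto)
    qed
  next
    case N
    show ?thesis
    proof (cases "(0, 0, 0, 0, 0, 1) \<in> S")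
      case True
      show ?thesis by (intro classifiedI'[of S2_6]) (use True N D ac rest in auto)
    next
      case False
      show ?thesis
      proof (cases "i \<ge> 0")
        case True
        then show ?thesis by (intro classifiedI'[of "S1_3 i"]) (use False N X ac rest in auto)
      next
        case neg: False
        show ?thesis by (intro weyl[of "S1_3 (-i)"]) (use neg False N weylX ac rest in auto)
      qed
    qed
  qed
qed

text \<open>At D a translation adds (k, -m) to (g, p), so k = -g and m = p clear the linear part.
  Shared opening of the hyperbolic, Borel and full sl_2 cases.\<close>

lemma kill_dilation_shift:
  assumes X: "(0, 1, 0, g, p, i) \<in> S"
    and N: "\<And>S' j. coord_subalg S' \<Longrightarrow> (0, 1, 0, 0, 0, j) \<in> S' \<Longrightarrow> S' = adj 1 0 0 1 (-g) p ` S \<Longrightarrow> classified S'"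
  shows "classified S"
proof (rule classified_adj[of 1 1 0 0 "-g" p], simp, rule N)
  show "coord_subalg (adj 1 0 0 1 (- g) p ` S)"
    by (rule coord_subalg_adj) (simp_all add: coord_subalg_axioms)
  show "(0, 1, 0, 0, 0, i + g * p / 2 + p * g / 2 - g * p / 2) \<in> adj 1 0 0 1 (- g) p ` S"
    by (rule adj_memI[OF X]) (simp add: adj_def)
qed simp

lemma classify_hyperbolic:
  assumes ac: "\<And>a b c g p i. (a, b, c, g, p, i) \<in> S \<Longrightarrow> a = 0 \<and> c = 0"
    and X: "(0, 1, 0, g, p, i) \<in> S"
  shows "classified S"
proof (rule kill_dilation_shift[OF X])
  fix S' j assume *: "coord_subalg S'" "(0, 1, 0, 0, 0, j) \<in> S'" "S' = adj 1 0 0 1 (-g) p ` S"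
  have "a = 0 \<and> c = 0" if "(a, b, c, g', p', i) \<in> S'" for a b c g' p' i
    using that unfolding *(3) by (rule adj_imageE) (drule ac, simp add: adj_def)
  then show "classified S'"
    by (rule coord_subalg.classify_hyperbolic_normalized[OF *(1) _ *(2)])
qed

section \<open>Elliptic case: projection spanned by P^t + K\<close>

text \<open>P^t + K rotates (g, p) to (-p, g) and has no real invariant line, so S contains either
  the whole radical or at most its centre.\<close>

lemma classify_elliptic_normalized:
  assumes bc: "\<And>a b c g p i. (a, b, c, g, p, i) \<in> S \<Longrightarrow> b = 0 \<and> c = a"
    and X: "(1, 0, 1, 0, 0, i) \<in> S"
  shows "classified S"
proof -
  have N: "(0, 0, 0, g, p, j - a * i) \<in> S" if "(a, b, c, g, p, j) \<in> S" for a b c g p j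
    using comb[OF that X, of 1 "-a"] bc[OF that] by simp
  have X0: "(1, 0, 1, 0, 0, 0) \<in> S" if "(0, 0, 0, 0, 0, 1) \<in> S"
    using comb[OF X that, of 1 "-i"] by simp
  show ?thesis
  proof (cases "\<exists>g p j. (0, 0, 0, g, p, j) \<in> S \<and> (g \<noteq> 0 \<or> p \<noteq> 0)")
    case True
    then obtain g p j where n: "(0, 0, 0, g, p, j) \<in> S" "g \<noteq> 0 \<or> p \<noteq> 0" by blast
    have n': "(0, 0, 0, -p, g, 0) \<in> S" using bracket_mem[OF X n(1)] by simp
    have "g * g - p * - p \<noteq> 0" using n(2) by (simp add: sum_squares_eq_zero_iff)
    then show ?thesis
      by (intro classifiedI'[of S4_5]) (use heis_mem[OF n(1) n'] center_mem[OF n(1) n'] X0 bc in auto)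
  next
    case False
    then have gp: "g = 0" "p = 0" if "(a, b, c, g, p, j) \<in> S" for a b c g p j
      using N[OF that] by blast+
    show ?thesis
    proof (cases "(0, 0, 0, 0, 0, 1) \<in> S")
      case True
      then show ?thesis by (intro classifiedI'[of S2_7]) (use X0 bc gp in auto)
    next
      case False
      have "j = a * i" if "(a, b, c, g, p, j) \<in> S" for a b c g p j
        using N[OF that] gp[OF that] unit(6)[of "j - a * i"] False by auto
      then show ?thesis by (intro classifiedI'[of "S1_4 i"]) (use X bc gp in auto)
    qed
  qed
qed

lemma classify_elliptic:
  assumes bc: "\<And>a b c g p i. (a, b, c, g, p, i) \<in> S \<Longrightarrow> b = 0 \<and> c = a"
    and X: "(1, 0, 1, g, p, i) \<in> S"
  shows "classified S"
proof (rule classified_adj[of 1 1 0 0 "-p" g])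
  interpret T: coord_subalg "adj 1 0 0 1 (- p) g ` S"
    by (rule coord_subalg_adj) (simp_all add: coord_subalg_axioms)
  have "\<exists>j. (1, 0, 1, 0, 0, j) \<in> adj 1 0 0 1 (- p) g ` S"
    by (rule exI, rule adj_memI[OF X]) (simp add: adj_def)
  moreover have "b = 0 \<and> c = a" if "(a, b, c, g', p', i) \<in> adj 1 0 0 1 (- p) g ` S" for a b c g' p' i
    using that by (rule adj_imageE) (drule bc, simp add: adj_def)
  ultimately show "classified (adj 1 0 0 1 (- p) g ` S)"
    using T.classify_elliptic_normalized by blast
qed simp

section \<open>Borel case: projection spanned by P^t and D\<close>

lemma classify_borel_normalized:
  assumes c: "\<And>a b c g p i. (a, b, c, g, p, i) \<in> S \<Longrightarrow> c = 0"
    and X: "(0, 1, 0, 0, 0, i) \<in> S" and Y: "(1, 0, 0, g, p, j) \<in> S"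
  shows "classified S"
proof -
  \<comment> \<open>P^t has weight -2 under D, so (ad X + 2) kills it and multiplies the G^x-, P^x-
    and I-parts by 3, 1, 2. None of these vanishes, so every perturbation of P^t lies in S and can
    be subtracted.\<close>
  have "(0, 0, 0, 3 * g, p, 2 * j) \<in> S"
    using comb[OF bracket_mem[OF X Y, simplified] Y, of 1 2] by simp
  note gpj = split_weights[OF X this]
  have "(1, 0, 0, 0, p, j) \<in> S" using comb[OF Y gpj(1), of 1 "-1/3"] by simp
  from comb[OF this gpj(2), of 1 "-1"] have "(1, 0, 0, 0, 0, j) \<in> S" by simp
  from comb[OF this gpj(3), of 1 "-1/2"] have Y0: "(1, 0, 0, 0, 0, 0) \<in> S" by simp
  have N: "(0, 0, 0, g, p, j - b * i) \<in> S" if "(a, b, c, g, p, j) \<in> S" for a b c g p j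
    using comb[OF comb[OF that X, of 1 "-b"] Y0, of 1 "-a"] c[OF that] by simp
  have rest: "(0, 0, 0, 1, 0, 0) \<notin> S \<Longrightarrow> g = 0" "(0, 0, 0, 0, 1, 0) \<notin> S \<Longrightarrow> p = 0"
    "(0, 0, 0, 0, 0, 1) \<notin> S \<Longrightarrow> j = b * i" if "(a, b, c, g, p, j) \<in> S" for a b c g p j
    using components_zero[OF X N[OF that]] by auto
  have D: "(0, 1, 0, 0, 0, 0) \<in> S" if "(0, 0, 0, 0, 0, 1) \<in> S"
    using comb[OF X that, of 1 "-i"] by simp
  consider (G) "(0, 0, 0, 1, 0, 0) \<in> S"
    | (P) "(0, 0, 0, 1, 0, 0) \<notin> S" "(0, 0, 0, 0, 1, 0) \<in> S"
    | (N) "(0, 0, 0, 1, 0, 0) \<notin> S" "(0, 0, 0, 0, 1, 0) \<notin> S" by blast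
  then show ?thesis
  proof cases
    case G
    have P: "(0, 0, 0, 0, 1, 0) \<in> S" using bracket_mem[OF Y0 G] by simp
    have "(0, 0, 0, 0, 0, 1) \<in> S" using center_mem[OF G P] by simp
    then show ?thesis by (intro classifiedI'[of S5_1]) (use G P D Y0 c in auto)
  next
    case P
    show ?thesis
    proof (cases "(0, 0, 0, 0, 0, 1) \<in> S")
      case True
      show ?thesis by (intro classifiedI'[of S4_2]) (use True P D Y0 c rest in auto)
    next
      case False
      show ?thesis by (intro classifiedI'[of "S3_2 i"]) (use False P X Y0 c rest in auto)
    qed
  next
    case N
    show ?thesis
    proof (cases "(0, 0, 0, 0, 0, 1) \<in> S")
      case True
      show ?thesis by (intro classifiedI'[of S3_3]) (use True N D Y0 c rest in auto)
    next
      case False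
      show ?thesis by (intro classifiedI'[of "S2_1 i"]) (use False N X Y0 c rest in auto)
    qed
  qed
qed

lemma classify_borel:
  assumes c: "\<And>a b c g p i. (a, b, c, g, p, i) \<in> S \<Longrightarrow> c = 0"
    and X: "(0, 1, 0, g, p, i) \<in> S" and Y: "(1, 0, 0, g', p', i') \<in> S"
  shows "classified S"
proof (rule kill_dilation_shift[OF X])
  fix S' j assume *: "coord_subalg S'" "(0, 1, 0, 0, 0, j) \<in> S'" "S' = adj 1 0 0 1 (-g) p ` S"
  have "\<exists>g p i. (1, 0, 0, g, p, i) \<in> S'"
    unfolding *(3) by (intro exI, rule adj_memI[OF Y]) (simp add: adj_def)
  moreover have "c = 0" if "(a, b, c, g', p', i) \<in> S'" for a b c g' p' i
    using that unfolding *(3) by (rule adj_imageE) (drule c, simp add: adj_def)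
  ultimately show "classified S'"
    using coord_subalg.classify_borel_normalized[OF *(1) _ *(2)] by blast
qed

section \<open>Projection onto all of sl_2\<close>

lemma classify_levi_normalized:
  assumes X: "(0, 1, 0, 0, 0, i) \<in> S" and Y: "(1, 0, 0, g, p, j) \<in> S" and Z: "(0, 0, 1, g', p', j') \<in> S"
    and proper: "S \<noteq> UNIV"
  shows "classified S"
proof -
  have "(0, 0, 0, 3 * g, p, 2 * j) \<in> S"
    using comb[OF bracket_mem[OF X Y, simplified] Y, of 1 2] by simp
  note gpj = split_weights[OF X this]
  have "(1, 0, 0, 0, p, j) \<in> S" using comb[OF Y gpj(1), of 1 "-1/3"] by simp
  from comb[OF this gpj(2), of 1 "-1"] have "(1, 0, 0, 0, 0, j) \<in> S" by simp
  from comb[OF this gpj(3), of 1 "-1/2"] have Y0: "(1, 0, 0, 0, 0, 0) \<in> S" by simp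
  \<comment> \<open>The same for K, of weight 2: (ad X - 2) has factors -1, -3, -2 on the
    radical.\<close>
  have "(0, 0, 0, - g', - 3 * p', - 2 * j') \<in> S"
    using comb[OF bracket_mem[OF X Z, simplified] Z, of 1 "-2"] by simp
  note gpj = split_weights[OF X this]
  have "(0, 0, 1, 0, p', j') \<in> S" using comb[OF Z gpj(1), of 1 1] by simp
  from comb[OF this gpj(2), of 1 "1/3"] have "(0, 0, 1, 0, 0, j') \<in> S" by simp
  from comb[OF this gpj(3), of 1 "1/2"] have Z0: "(0, 0, 1, 0, 0, 0) \<in> S" by simp
  have D: "(0, 1, 0, 0, 0, 0) \<in> S" using bracket_mem[OF Y0 Z0] by simp
  have N: "(0, 0, 0, g, p, j) \<in> S" if "(a, b, c, g, p, j) \<in> S" for a b c g p j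
    using comb[OF comb[OF comb[OF that D, of 1 "-b"] Y0, of 1 "-a"] Z0, of 1 "-c"] by simp
  \<comment> \<open>The radical modulo its centre is irreducible under sl_2: P^t and K exchange G^x
    and P^x, so one of them forces both, then I, and S would be everything.\<close>
  have "(0, 0, 0, 1, 0, 0) \<notin> S \<and> (0, 0, 0, 0, 1, 0) \<notin> S"
  proof (rule ccontr)
    assume "\<not> ?thesis"
    moreover have "(0, 0, 0, 0, 1, 0) \<in> S" if "(0, 0, 0, 1, 0, 0) \<in> S"
      using bracket_mem[OF Y0 that] by simp
    moreover have "(0, 0, 0, 1, 0, 0) \<in> S" if "(0, 0, 0, 0, 1, 0) \<in> S"
      using bracket_mem[OF that Z0] by simp
    ultimately have GP: "(0, 0, 0, 1, 0, 0) \<in> S" "(0, 0, 0, 0, 1, 0) \<in> S" by blast+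
    have I: "(0, 0, 0, 0, 0, 1) \<in> S" using center_mem[OF GP] by simp
    have "(a, b, c, g, p, j) \<in> S" for a b c g p j
      using comb[OF comb[OF comb[OF comb[OF comb[OF Y0 D, of a b] Z0, of 1 c] GP(1), of 1 g] GP(2), of 1 p] I, of 1 j]
      by simp
    then show False using proper by auto
  qed
  then have gp: "g = 0" "p = 0" if "(a, b, c, g, p, j) \<in> S" for a b c g p j
    using components_zero[OF D N[OF that]] by auto
  show ?thesis
  proof (cases "(0, 0, 0, 0, 0, 1) \<in> S")
    case True
    show ?thesis by (intro classifiedI'[of S4_1]) (use True D Y0 Z0 gp in auto)
  next
    case False
    have "j = 0" if "(a, b, c, g, p, j) \<in> S" for a b c g p j
      using components_zero(3)[OF D N[OF that] False] .
    then show ?thesis by (intro classifiedI'[of S3_1]) (use D Y0 Z0 gp in auto)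
  qed
qed

end

section \<open>Inverse action and the discriminant\<close>

lemma adj_inverse:
  assumes "\<alpha> * \<delta> - \<beta> * \<gamma> = 1"
  shows "adj \<delta> (- \<beta>) (- \<gamma>) \<alpha> (m * \<gamma> - k * \<delta>) (k * \<beta> - m * \<alpha>) (adj \<alpha> \<beta> \<gamma> \<delta> k m v) = v"
proof -
  have "\<delta> * \<alpha> + - \<beta> * \<gamma> = 1" "\<delta> * \<beta> + - \<beta> * \<delta> = 0" "- \<gamma> * \<alpha> + \<alpha> * \<gamma> = 0" "- \<gamma> * \<beta> + \<alpha> * \<delta> = 1"
    using assms by (simp_all add: mult.commute)
  moreover have "k + ((m * \<gamma> - k * \<delta>) * \<alpha> + (k * \<beta> - m * \<alpha>) * \<gamma>) = k * (1 - (\<alpha> * \<delta> - \<beta> * \<gamma>))"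
    "m + ((m * \<gamma> - k * \<delta>) * \<beta> + (k * \<beta> - m * \<alpha>) * \<delta>) = m * (1 - (\<alpha> * \<delta> - \<beta> * \<gamma>))"
    by (simp_all add: algebra_simps)
  ultimately have "adj \<delta> (- \<beta>) (- \<gamma>) \<alpha> (m * \<gamma> - k * \<delta>) (k * \<beta> - m * \<alpha>) (adj \<alpha> \<beta> \<gamma> \<delta> k m v) = adj 1 0 0 1 0 0 v"
    unfolding adj_adj assms by simp
  then show ?thesis by (cases v) (simp add: adj_def)
qed

lemma inj_adj:
  assumes "\<alpha> * \<delta> - \<beta> * \<gamma> = 1"
  shows "inj (adj \<alpha> \<beta> \<gamma> \<delta> k m)"
  by (rule inj_on_inverseI) (rule adj_inverse[OF assms])

lemma adj_image_neq_UNIV: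
  assumes "\<alpha> * \<delta> - \<beta> * \<gamma> = 1" "S \<noteq> UNIV"
  shows "adj \<alpha> \<beta> \<gamma> \<delta> k m ` S \<noteq> UNIV"
proof
  assume "adj \<alpha> \<beta> \<gamma> \<delta> k m ` S = UNIV"
  then have "adj \<alpha> \<beta> \<gamma> \<delta> k m ` S = adj \<alpha> \<beta> \<gamma> \<delta> k m ` UNIV" by blast
  then show False using assms(2) inj_image_eq_iff[OF inj_adj[OF assms(1)]] by metis
qed

text \<open>A quarter of the discriminant of a + 2bt + ct^2; up to a factor, the Killing form of
  sl_2.\<close>

fun disc :: "coords \<Rightarrow> real" where
  "disc (a, b, c, g, p, i) = b\<^sup>2 - a * c"

fun in_heis :: "coords \<Rightarrow> bool" where
  "in_heis (a, b, c, g, p, i) \<longleftrightarrow> a = 0 \<and> b = 0 \<and> c = 0"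

lemma disc_adj:
  assumes "\<alpha> * \<delta> - \<beta> * \<gamma> = 1"
  shows "disc (adj \<alpha> \<beta> \<gamma> \<delta> k m v) = disc v"
proof -
  obtain a b c g p i where v: "v = (a, b, c, g, p, i)" by (cases v)
  have "(b * (\<alpha> * \<delta> + \<beta> * \<gamma>) - a * \<alpha> * \<gamma> - c * \<beta> * \<delta>)\<^sup>2 -
    (a * \<alpha>\<^sup>2 - 2 * b * \<alpha> * \<beta> + c * \<beta>\<^sup>2) * (a * \<gamma>\<^sup>2 - 2 * b * \<gamma> * \<delta> + c * \<delta>\<^sup>2) =
    (\<alpha> * \<delta> - \<beta> * \<gamma>)\<^sup>2 * (b\<^sup>2 - a * c)"
    by (simp add: algebra_simps power2_eq_square)
  then show ?thesis using assms by (simp add: v adj_def)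
qed

lemma in_heis_adj:
  assumes "\<alpha> * \<delta> - \<beta> * \<gamma> = 1"
  shows "in_heis (adj \<alpha> \<beta> \<gamma> \<delta> k m v) \<longleftrightarrow> in_heis v"
proof -
  have *: "in_heis v \<Longrightarrow> in_heis (adj \<alpha> \<beta> \<gamma> \<delta> k m v)" for \<alpha> \<beta> \<gamma> \<delta> k m v
    by (cases v) (simp add: adj_def)
  show ?thesis
    using *[of "adj \<alpha> \<beta> \<gamma> \<delta> k m v" \<delta> "- \<beta>" "- \<gamma>" \<alpha> "m * \<gamma> - k * \<delta>" "k * \<beta> - m * \<alpha>"] *
    unfolding adj_inverse[OF assms] by blast
qed

section \<open>Determining the projection to sl_2\<close>

context coord_subalg
begin

lemma classify_levi:
  assumes X: "(0, 1, 0, g, p, i) \<in> S" and Y: "(1, 0, 0, g', p', i') \<in> S" and Z: "(0, 0, 1, g'', p'', i'') \<in> S"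
    and proper: "S \<noteq> UNIV"
  shows "classified S"
proof (rule kill_dilation_shift[OF X])
  fix S' j assume *: "coord_subalg S'" "(0, 1, 0, 0, 0, j) \<in> S'" "S' = adj 1 0 0 1 (-g) p ` S"
  have "\<exists>g p i. (1, 0, 0, g, p, i) \<in> S'"
    unfolding *(3) by (intro exI, rule adj_memI[OF Y]) (simp add: adj_def)
  moreover have "\<exists>g p i. (0, 0, 1, g, p, i) \<in> S'"
    unfolding *(3) by (intro exI, rule adj_memI[OF Z]) (simp add: adj_def)
  moreover have "S' \<noteq> UNIV" unfolding *(3) by (rule adj_image_neq_UNIV[OF _ proper]) simp
  ultimately show "classified S'"
    using coord_subalg.classify_levi_normalized[OF *(1) *(2)] by blast
qed

text \<open>If some element has c \<noteq> 0, its bracket with P^t has quadratic part (2b, c, 0),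
  giving D and then K modulo the radical. Otherwise the projection is the Borel subalgebra or the
  line of P^t.\<close>

lemma classify_with_translation:
  assumes Y: "(1, 0, 0, g, p, i) \<in> S" and proper: "S \<noteq> UNIV"
  shows "classified S"
proof (cases "\<exists>a b c g p i. (a, b, c, g, p, i) \<in> S \<and> c \<noteq> 0")
  case True
  then obtain a b c g' p' i' where w: "(a, b, c, g', p', i') \<in> S" "c \<noteq> 0" by blast
  have "\<exists>g p i. (2 * b, c, 0, g, p, i) \<in> S" using bracket_mem[OF Y w(1)] by (simp, blast)
  then obtain g1 p1 i1 where v: "(2 * b, c, 0, g1, p1, i1) \<in> S" by blast
  have "\<exists>g p i. (0, 1, 0, g, p, i) \<in> S"
    using comb[OF v Y, of "1 / c" "- 2 * b / c"] w(2) by (simp, blast)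
  then obtain g2 p2 i2 where X: "(0, 1, 0, g2, p2, i2) \<in> S" by blast
  have "\<exists>g p i. (a / c, 0, 1, g, p, i) \<in> S"
    using comb[OF w(1) X, of "1 / c" "- b / c"] w(2) by (simp, blast)
  then obtain g3 p3 i3 where u: "(a / c, 0, 1, g3, p3, i3) \<in> S" by blast
  have "\<exists>g p i. (0, 0, 1, g, p, i) \<in> S"
    using comb[OF u Y, of 1 "- a / c"] by (simp, blast)
  then show ?thesis using classify_levi[OF X Y _ proper] by blast
next
  case c: False
  show ?thesis
  proof (cases "\<exists>a b c g p i. (a, b, c, g, p, i) \<in> S \<and> b \<noteq> 0")
    case True
    then obtain a b c g' p' i' where w: "(a, b, c, g', p', i') \<in> S" "b \<noteq> 0" by blast
    have "c = 0" using c w(1) by blast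
    then have "\<exists>g p i. (0, 1, 0, g, p, i) \<in> S"
      using comb[OF w(1) Y, of "1 / b" "- a / b"] w(2) by (simp, blast)
    then show ?thesis using classify_borel[OF _ _ Y] c by blast
  next
    case False
    then show ?thesis using classify_parabolic[OF _ Y] c by blast
  qed
qed

text \<open>Modulo D an element has quadratic part (a, 0, c), and ad D sends it to (-2a, 0, 2c).
  Combining the two isolates multiples of P^t and K, whose discriminant is 0.\<close>

lemma classify_with_dilation:
  assumes X: "(0, 1, 0, g, p, i) \<in> S" and null: "\<And>v. v \<in> S \<Longrightarrow> disc v = 0 \<Longrightarrow> in_heis v"
  shows "classified S"
proof (rule classify_hyperbolic[OF _ X])
  fix a b c g' p' i' assume v: "(a, b, c, g', p', i') \<in> S"
  have "\<exists>g p i. (a, 0, c, g, p, i) \<in> S"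
    using comb[OF v X, of 1 "-b"] by (simp, blast)
  then obtain g1 p1 i1 where w: "(a, 0, c, g1, p1, i1) \<in> S" by blast
  have "\<exists>g p i. (- 2 * a, 0, 2 * c, g, p, i) \<in> S"
    using bracket_mem[OF X w] by (simp, blast)
  then obtain g2 p2 i2 where u: "(- 2 * a, 0, 2 * c, g2, p2, i2) \<in> S" by blast
  show "a = 0 \<and> c = 0"
    using null[OF comb[OF w u, of 2 1]] null[OF comb[OF w u, of 2 "-1"]] by simp
qed

text \<open>Subtracting a multiple of P^t + K makes the first entry 0, so the discriminant becomes
  b^2 and must vanish; the rest is then a null form.\<close>

lemma classify_with_rotation:
  assumes X: "(1, 0, 1, g, p, i) \<in> S" and null: "\<And>v. v \<in> S \<Longrightarrow> disc v = 0 \<Longrightarrow> in_heis v"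
    and pos: "\<And>v. v \<in> S \<Longrightarrow> disc v \<le> 0"
  shows "classified S"
proof (rule classify_elliptic[OF _ X])
  fix a b c g' p' i' assume v: "(a, b, c, g', p', i') \<in> S"
  have "\<exists>g p i. (0, b, c - a, g, p, i) \<in> S"
    using comb[OF v X, of 1 "-a"] by (simp, blast)
  then obtain g1 p1 i1 where w: "(0, b, c - a, g1, p1, i1) \<in> S" by blast
  show "b = 0 \<and> c = a"
    using pos[OF w] null[OF w] by simp
qed

end

section \<open>Normal forms of a quadratic form under SL(2)\<close>

lemma translation_conjugate:
  assumes "b\<^sup>2 - a * c = 0" "\<not> in_heis (a, b, c, g, p, i)" "coord_subalg S" "(a, b, c, g, p, i) \<in> S"
  shows "\<exists>\<alpha> \<beta> \<gamma> \<delta> g p i. \<alpha> * \<delta> - \<beta> * \<gamma> = 1 \<and> (1, 0, 0, g, p, i) \<in> adj \<alpha> \<beta> \<gamma> \<delta> 0 0 ` S"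
proof -
  have "\<exists>\<alpha> \<beta> \<gamma> \<delta> r g' p'. \<alpha> * \<delta> - \<beta> * \<gamma> = 1 \<and> r \<noteq> 0 \<and>
    adj \<alpha> \<beta> \<gamma> \<delta> 0 0 (a, b, c, g, p, i) = (r, 0, 0, g', p', i)"
  proof (cases "a = 0")
    case True
    then have b: "b = 0" and c: "c \<noteq> 0" using assms(1,2) by simp_all
    have "adj 0 1 (- 1) 0 0 0 (a, b, c, g, p, i) = (c, 0, 0, p, - g, i)"
      by (simp add: adj_def True b)
    moreover have "0 * 0 - 1 * - 1 = (1::real)" by simp
    ultimately show ?thesis using c by blast
  next
    case False
    \<comment> \<open>The double root of a z^2 - 2 b z + c: a shear by it removes both b and
      c.\<close>
    define \<gamma> where "\<gamma> = b / a"
    have \<gamma>: "a * \<gamma> = b" using False by (simp add: \<gamma>_def)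
    have "a * c = a * (b * \<gamma>)" using assms(1) \<gamma> by algebra
    then have c: "c = b * \<gamma>" using False by simp
    have 3: "a * \<gamma>\<^sup>2 - 2 * b * \<gamma> + c = 0"
      unfolding c \<gamma>[symmetric] by (simp add: power2_eq_square)
    have "adj 1 0 \<gamma> 1 0 0 (a, b, c, g, p, i) = (a, 0, 0, g - p * \<gamma>, p, i)"
      using 3 \<gamma> by (simp add: adj_def)
    moreover have "1 * 1 - 0 * \<gamma> = 1" by simp
    ultimately show ?thesis using False by blast
  qed
  then obtain \<alpha> \<beta> \<gamma> \<delta> r g' p' where det: "\<alpha> * \<delta> - \<beta> * \<gamma> = 1" and r: "r \<noteq> 0"
    and eq: "adj \<alpha> \<beta> \<gamma> \<delta> 0 0 (a, b, c, g, p, i) = (r, 0, 0, g', p', i)" by blast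
  note mem = adj_memI[OF assms(4) eq]
  have "(1, 0, 0, g' / r, p' / r, i / r) \<in> adj \<alpha> \<beta> \<gamma> \<delta> 0 0 ` S"
    using coord_subalg.comb[OF coord_subalg_adj[OF det assms(3)] mem mem, of "1 / r" 0] r by simp
  then show ?thesis using det by blast
qed

lemma dilation_conjugate:
  assumes "b\<^sup>2 - a * c > 0" "coord_subalg S" "(a, b, c, g, p, i) \<in> S"
  shows "\<exists>\<alpha> \<beta> \<gamma> \<delta> g p i. \<alpha> * \<delta> - \<beta> * \<gamma> = 1 \<and> (0, 1, 0, g, p, i) \<in> adj \<alpha> \<beta> \<gamma> \<delta> 0 0 ` S"
proof -
  define d where "d = sqrt (b\<^sup>2 - a * c)"
  have d: "d > 0" "d\<^sup>2 = b\<^sup>2 - a * c" using assms(1) by (auto simp: d_def)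
  have "\<exists>\<alpha> \<beta> \<gamma> \<delta> r g' p'. \<alpha> * \<delta> - \<beta> * \<gamma> = 1 \<and> r \<noteq> 0 \<and>
    adj \<alpha> \<beta> \<gamma> \<delta> 0 0 (a, b, c, g, p, i) = (0, r, 0, g', p', i)"
  proof (cases "a = 0")
    case True
    then have "b \<noteq> 0" using assms(1) by auto
    then have "adj 1 0 (c / (2 * b)) 1 0 0 (a, b, c, g, p, i) = (0, b, 0, g - p * (c / (2 * b)), p, i)"
      by (simp add: adj_def True)
    moreover have "1 * 1 - 0 * (c / (2 * b)) = 1" by simp
    ultimately show ?thesis using \<open>b \<noteq> 0\<close> by blast
  next
    case False
    \<comment> \<open>\<gamma> is a root of a z^2 - 2 b z + c, which clears the third entry. \<beta>
      then clears the first, and \<alpha> restores determinant one.\<close>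
    define \<gamma> where "\<gamma> = (b + d) / a"
    define \<beta> where "\<beta> = - a / (2 * d)"
    have \<gamma>: "a * \<gamma> = b + d" and \<beta>: "2 * (d * \<beta>) = - a" using False d by (auto simp: \<gamma>_def \<beta>_def)
    have c: "c = (b - d) * \<gamma>"
    proof -
      have "a * c = (b - d) * (b + d)" using d(2) by (simp add: algebra_simps power2_eq_square)
      then show ?thesis using False \<gamma> by (metis mult.left_commute mult_left_cancel)
    qed
    define \<alpha> where "\<alpha> = 1 + \<beta> * \<gamma>"
    have 1: "a * \<alpha>\<^sup>2 - 2 * b * \<alpha> * \<beta> + c * \<beta>\<^sup>2 = 0"
      using \<gamma> \<beta> c \<alpha>_def by algebra
    have 2: "b * (\<alpha> + \<beta> * \<gamma>) - a * \<alpha> * \<gamma> - c * \<beta> = - d"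
      using \<gamma> \<beta> c \<alpha>_def by algebra
    have 3: "a * \<gamma>\<^sup>2 - 2 * b * \<gamma> + c = 0"
      using \<gamma> \<beta> c by algebra
    have "adj \<alpha> \<beta> \<gamma> 1 0 0 (a, b, c, g, p, i) = (0, - d, 0, g - p * \<gamma>, p * \<alpha> - g * \<beta>, i)"
      using 1 2 3 by (simp add: adj_def)
    moreover have "\<alpha> * 1 - \<beta> * \<gamma> = 1" by (simp add: \<alpha>_def)
    ultimately show ?thesis using d(1) by (metis neg_equal_0_iff_equal order_less_irrefl)
  qed
  then obtain \<alpha> \<beta> \<gamma> \<delta> r g' p' where det: "\<alpha> * \<delta> - \<beta> * \<gamma> = 1" and r: "r \<noteq> 0"
    and eq: "adj \<alpha> \<beta> \<gamma> \<delta> 0 0 (a, b, c, g, p, i) = (0, r, 0, g', p', i)" by blast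
  note mem = adj_memI[OF assms(3) eq]
  have "(0, 1, 0, g' / r, p' / r, i / r) \<in> adj \<alpha> \<beta> \<gamma> \<delta> 0 0 ` S"
    using coord_subalg.comb[OF coord_subalg_adj[OF det assms(2)] mem mem, of "1 / r" 0] r by simp
  then show ?thesis using det by blast
qed

lemma rotation_conjugate:
  assumes "b\<^sup>2 - a * c < 0" "coord_subalg S" "(a, b, c, g, p, i) \<in> S"
  shows "\<exists>\<alpha> \<beta> \<gamma> \<delta> g p i. \<alpha> * \<delta> - \<beta> * \<gamma> = 1 \<and> (1, 0, 1, g, p, i) \<in> adj \<alpha> \<beta> \<gamma> \<delta> 0 0 ` S"
proof -
  have a: "a \<noteq> 0" using assms(1) by (auto simp: not_less)
  \<comment> \<open>Completing the square by \<beta> = b / a leaves diagonal entries a and a q. A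
    diagonal scaling by \<alpha> makes them a \<alpha>^2 and a q / \<alpha>^2, equal exactly when
    \<alpha>^4 = q.\<close>
  define q where "q = (a * c - b\<^sup>2) / a\<^sup>2"
  have q: "q > 0" "a\<^sup>2 * q = a * c - b\<^sup>2" using assms(1) a by (auto simp: q_def)
  define \<alpha> where "\<alpha> = sqrt (sqrt q)"
  have \<alpha>: "\<alpha> > 0" "\<alpha>^4 = q"
    using q(1) power_mult[of \<alpha> 2 2] by (auto simp: \<alpha>_def)
  define \<beta> where "\<beta> = b / a"
  have \<beta>: "a * \<beta> = b" using a by (simp add: \<beta>_def)
  define \<gamma> where "\<gamma> = \<beta> / \<alpha>"
  define \<delta> where "\<delta> = 1 / \<alpha>"
  have \<gamma>\<delta>: "\<gamma> = \<beta> * \<delta>" "\<alpha> * \<delta> = 1" using \<alpha>(1) by (auto simp: \<gamma>_def \<delta>_def)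
  have "a * c = a * (a * \<alpha>^4 + b * \<beta>)"
    using q(2) \<beta> unfolding \<alpha>(2) by algebra
  then have c: "c = a * \<alpha>^4 + b * \<beta>" using a by simp
  have "a * \<alpha> * \<gamma> = (a * \<beta>) * (\<alpha> * \<delta>)" by (simp add: \<gamma>\<delta>(1))
  then have 2: "b * (\<alpha> * \<delta>) - a * \<alpha> * \<gamma> = 0" using \<beta> by (simp only: right_minus_eq)
  have "a * \<gamma>\<^sup>2 - 2 * b * \<gamma> * \<delta> + c * \<delta>\<^sup>2 = ((a * \<beta>) * \<beta> - b * \<beta>) * \<delta>\<^sup>2 + a * \<alpha>\<^sup>2 * (\<alpha> * \<delta>)\<^sup>2"
    by (simp add: \<gamma>\<delta>(1) c power2_eq_square power4_eq_xxxx algebra_simps)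
  then have 3: "a * \<gamma>\<^sup>2 - 2 * b * \<gamma> * \<delta> + c * \<delta>\<^sup>2 = a * \<alpha>\<^sup>2"
    unfolding \<beta> \<gamma>\<delta>(2) by simp
  have eq: "adj \<alpha> 0 \<gamma> \<delta> 0 0 (a, b, c, g, p, i) = (a * \<alpha>\<^sup>2, 0, a * \<alpha>\<^sup>2, g * \<delta> - p * \<gamma>, p * \<alpha>, i)"
    using 2 3 by (simp add: adj_def)
  have det: "\<alpha> * \<delta> - 0 * \<gamma> = 1" using \<gamma>\<delta> by simp
  note mem = adj_memI[OF assms(3) eq]
  have "\<exists>g p i. (1, 0, 1, g, p, i) \<in> adj \<alpha> 0 \<gamma> \<delta> 0 0 ` S"
    using coord_subalg.comb[OF coord_subalg_adj[OF det assms(2)] mem mem, of "1 / (a * \<alpha>\<^sup>2)" 0] a \<alpha>(1)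
    by (simp, blast)
  then show ?thesis using det by blast
qed

text \<open>The order of the tests matters: the dilation and rotation cases need null forms outside
  the radical excluded, and the rotation case also positive discriminants.\<close>

lemma coord_subalgebra_classified:
  assumes S: "coord_subalg S" and "S \<noteq> {0}" "S \<noteq> UNIV"
  shows "classified S"
proof (cases "\<forall>v\<in>S. disc v = 0 \<longrightarrow> in_heis v")
  case False
  then obtain a b c g p i where "b\<^sup>2 - a * c = 0" "\<not> in_heis (a, b, c, g, p, i)" "(a, b, c, g, p, i) \<in> S"
    by (auto simp del: in_heis.simps)
  from translation_conjugate[OF this(1,2) S this(3)]
  obtain \<alpha> \<beta> \<gamma> \<delta> g p i where *: "\<alpha> * \<delta> - \<beta> * \<gamma> = 1" "(1, 0, 0, g, p, i) \<in> adj \<alpha> \<beta> \<gamma> \<delta> 0 0 ` S"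
    by blast
  show ?thesis
    by (rule classified_adj[OF *(1)], rule coord_subalg.classify_with_translation[OF _ *(2)])
      (rule coord_subalg_adj[OF *(1) S], rule adj_image_neq_UNIV[OF *(1) assms(3)])
next
  case null: True
  have null': "in_heis v" if "v \<in> adj \<alpha> \<beta> \<gamma> \<delta> 0 0 ` S" "disc v = 0" "\<alpha> * \<delta> - \<beta> * \<gamma> = 1" for v \<alpha> \<beta> \<gamma> \<delta>
  proof -
    from that(1) obtain w where "w \<in> S" "v = adj \<alpha> \<beta> \<gamma> \<delta> 0 0 w" by blast
    then show ?thesis using that(2) null disc_adj[OF that(3)] in_heis_adj[OF that(3)] by metis
  qed
  show ?thesis
  proof (cases "\<exists>v\<in>S. disc v > 0")
    case True
    then obtain a b c g p i where "b\<^sup>2 - a * c > 0" "(a, b, c, g, p, i) \<in> S" by auto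
    from dilation_conjugate[OF this(1) S this(2)]
    obtain \<alpha> \<beta> \<gamma> \<delta> g p i where *: "\<alpha> * \<delta> - \<beta> * \<gamma> = 1" "(0, 1, 0, g, p, i) \<in> adj \<alpha> \<beta> \<gamma> \<delta> 0 0 ` S"
      by blast
    show ?thesis
      by (rule classified_adj[OF *(1)], rule coord_subalg.classify_with_dilation[OF coord_subalg_adj[OF *(1) S] *(2)])
        (rule null'[OF _ _ *(1)])
  next
    case pos: False
    show ?thesis
    proof (cases "\<exists>v\<in>S. disc v < 0")
      case True
      then obtain a b c g p i where "b\<^sup>2 - a * c < 0" "(a, b, c, g, p, i) \<in> S" by auto
      from rotation_conjugate[OF this(1) S this(2)]
      obtain \<alpha> \<beta> \<gamma> \<delta> g p i where *: "\<alpha> * \<delta> - \<beta> * \<gamma> = 1" "(1, 0, 1, g, p, i) \<in> adj \<alpha> \<beta> \<gamma> \<delta> 0 0 ` S"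
        by blast
      have le: "disc v \<le> 0" if "v \<in> adj \<alpha> \<beta> \<gamma> \<delta> 0 0 ` S" for v
      proof -
        from that obtain w where "w \<in> S" "v = adj \<alpha> \<beta> \<gamma> \<delta> 0 0 w" by blast
        then show ?thesis using pos disc_adj[OF *(1)] by (metis not_less)
      qed
      show ?thesis
        by (rule classified_adj[OF *(1)], rule coord_subalg.classify_with_rotation[OF coord_subalg_adj[OF *(1) S] *(2)])
          (erule (1) null'[OF _ _ *(1)], erule le)
    next
      case False
      then have "in_heis v" if "v \<in> S" for v using that pos null by (meson linorder_neqE_linordered_idom)
      then have "a = 0 \<and> b = 0 \<and> c = 0" if "(a, b, c, g, p, i) \<in> S" for a b c g p i
        using in_heis.simps that by blast
      then show ?thesis using coord_subalg.classify_heisenberg[OF S _ assms(2)] by blast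
    qed
  qed
qed

section \<open>Inequivalence\<close>

text \<open>The subtracted term is the resultant of \<open>a + 2bt + ct\<^sup>2\<close> and \<open>gt + p\<close>.\<close>

fun cubic_inv :: "coords \<Rightarrow> real" where
  "cubic_inv (a, b, c, g, p, i) = 4 * (b\<^sup>2 - a * c) * i - (a * g\<^sup>2 - 2 * b * g * p + c * p\<^sup>2)"

text \<open>If the discriminant is nonzero, a translation clears the linear part and the value
  becomes 4 * \<open>disc\<close> times the central coordinate, so it recovers \<mu> and \<nu>. On
  null forms it is minus the resultant and tells P^t + G^x from P^t + \<delta> I.\<close>

lemma cubic_inv_adj:
  assumes "\<alpha> * \<delta> - \<beta> * \<gamma> = 1"
  shows "cubic_inv (adj \<alpha> \<beta> \<gamma> \<delta> k m v) = cubic_inv v"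
proof -
  have heis: "cubic_inv (heis k m v) = cubic_inv v" for v
    by (cases v) (simp add: algebra_simps power2_eq_square add_divide_distrib diff_divide_distrib)
  have "cubic_inv (sl2 \<alpha> \<beta> \<gamma> \<delta> v) = (\<alpha> * \<delta> - \<beta> * \<gamma>)\<^sup>2 * cubic_inv v" for v
    by (cases v) (simp add: algebra_simps power2_eq_square)
  then show ?thesis by (simp add: adj_def heis assms)
qed

text \<open>The cubic invariant is tested on null forms only, which keeps the signature constant
  along each parameter family.\<close>

definition signature :: "coords set \<Rightarrow> nat \<times> bool \<times> bool \<times> bool \<times> bool \<times> bool" where
  "signature S = (dim S, (0, 0, 0, 0, 0, 1) \<in> S, \<exists>v\<in>S. disc v > 0, \<exists>v\<in>S. disc v < 0,
    \<exists>v\<in>S. disc v = 0 \<and> \<not> in_heis v, \<exists>v\<in>S. disc v = 0 \<and> cubic_inv v \<noteq> 0)"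

lemma signature_adj:
  assumes det: "\<alpha> * \<delta> - \<beta> * \<gamma> = 1"
  shows "signature (adj \<alpha> \<beta> \<gamma> \<delta> k m ` S) = signature S"
proof -
  have "dim (adj \<alpha> \<beta> \<gamma> \<delta> k m ` S) = dim S"
    by (rule dim_image_eq[OF linear_adj]) (rule inj_on_subset[OF inj_adj[OF det] subset_UNIV])
  moreover have "(0, 0, 0, 0, 0, 1) = adj \<alpha> \<beta> \<gamma> \<delta> k m (0, 0, 0, 0, 0, 1)"
    by (simp add: adj_def)
  then have "(0, 0, 0, 0, 0, 1) \<in> adj \<alpha> \<beta> \<gamma> \<delta> k m ` S \<longleftrightarrow> (0, 0, 0, 0, 0, 1) \<in> S"
    using inj_image_mem_iff[OF inj_adj[OF det]] by metis
  ultimately show ?thesis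
    by (simp add: signature_def disc_adj[OF det] in_heis_adj[OF det] cubic_inv_adj[OF det])
qed

text \<open>Different constructors receive different values, so only parameters within one family
  remain to be compared.\<close>

fun label_signature :: "label \<Rightarrow> nat \<times> bool \<times> bool \<times> bool \<times> bool \<times> bool" where
  "label_signature S1_1 = (1, False, False, False, True, True)"
| "label_signature (S1_2 _) = (1, False, False, False, True, False)"
| "label_signature (S1_3 _) = (1, False, True, False, False, False)"
| "label_signature (S1_4 _) = (1, False, False, True, False, False)"
| "label_signature S1_5 = (1, False, False, False, False, False)"
| "label_signature S1_6 = (1, True, False, False, False, False)"
| "label_signature (S2_1 _) = (2, False, True, False, True, False)"
| "label_signature S2_2 = (2, True, False, False, True, True)"
| "label_signature (S2_3 _) = (2, False, False, False, True, False)"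
| "label_signature S2_4 = (2, True, False, False, True, False)"
| "label_signature (S2_5 _) = (2, False, True, False, False, False)"
| "label_signature S2_6 = (2, True, True, False, False, False)"
| "label_signature S2_7 = (2, True, False, True, False, False)"
| "label_signature S2_8 = (2, True, False, False, False, False)"
| "label_signature S3_1 = (3, False, True, True, True, False)"
| "label_signature (S3_2 _) = (3, False, True, False, True, False)"
| "label_signature S3_3 = (3, True, True, False, True, False)"
| "label_signature S3_4 = (3, True, False, False, True, True)"
| "label_signature S3_5 = (3, True, False, False, True, False)"
| "label_signature S3_6 = (3, True, True, False, False, False)"
| "label_signature S3_7 = (3, True, False, False, False, False)"
| "label_signature S4_1 = (4, True, True, True, True, False)"
| "label_signature S4_2 = (4, True, True, False, True, False)"
| "label_signature S4_3 = (4, True, False, False, True, True)"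
| "label_signature S4_4 = (4, True, True, False, False, False)"
| "label_signature S4_5 = (4, True, False, True, False, False)"
| "label_signature S5_1 = (5, True, True, False, True, True)"

lemma signature_coord_eqs: "signature (Collect (coord_eqs l)) = label_signature l"
proof -
  have ex: "\<exists>x::real. x \<noteq> 0" "\<exists>x::real. 0 < x * x"
    by (rule exI[of _ 1], simp)+
  have ex1: "\<exists>a b c::real. a * c < b\<^sup>2"
    by (rule exI[of _ 0], rule exI[of _ 1], rule exI[of _ 0]) simp
  have ex2: "\<exists>a b c::real. b\<^sup>2 < a * c"
    by (rule exI[of _ 1], rule exI[of _ 0], rule exI[of _ 1]) simp
  have ex3: "\<exists>a b c::real. b\<^sup>2 = a * c \<and> (b = 0 \<longrightarrow> a = 0 \<longrightarrow> c \<noteq> 0)"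
    by (rule exI[of _ 1], rule exI[of _ 0], rule exI[of _ 0]) simp
  have *: "Bex (Collect Q) P \<longleftrightarrow> (\<exists>a b c g p i. Q (a, b, c, g, p, i) \<and> P (a, b, c, g, p, i))" for Q P :: "coords \<Rightarrow> bool"
    by auto
  show ?thesis
    unfolding signature_def dim_coord_eqs *
    by (cases l) (simp_all add: ex ex1 ex2 ex3)
qed

lemma conjugate_signature: "conjugate S T \<Longrightarrow> signature S = signature T"
  unfolding conjugate_def using signature_adj by metis

lemma conjugateE:
  assumes "conjugate (Collect (coord_eqs l)) (Collect (coord_eqs l'))"
  obtains \<alpha> \<beta> \<gamma> \<delta> k m where "\<alpha> * \<delta> - \<beta> * \<gamma> = 1"
    "\<And>v. coord_eqs l v \<Longrightarrow> coord_eqs l' (adj \<alpha> \<beta> \<gamma> \<delta> k m v)"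
proof -
  from assms obtain \<alpha> \<beta> \<gamma> \<delta> k m where det: "\<alpha> * \<delta> - \<beta> * \<gamma> = 1"
    and eq: "adj \<alpha> \<beta> \<gamma> \<delta> k m ` Collect (coord_eqs l) = Collect (coord_eqs l')"
    unfolding conjugate_def by blast
  have "coord_eqs l' (adj \<alpha> \<beta> \<gamma> \<delta> k m v)" if "coord_eqs l v" for v
    using eq imageI[of v "Collect (coord_eqs l)" "adj \<alpha> \<beta> \<gamma> \<delta> k m"] that by simp
  then show ?thesis by (rule that[OF det])
qed

section \<open>Separating parameters within a family\<close>

lemma sgn_scale_unique:
  fixes x y r :: real
  assumes "x \<in> {-1, 0, 1}" "y \<in> {-1, 0, 1}" "x = r\<^sup>2 * y" "r \<noteq> 0"
  shows "x = y"
proof -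
  have "sgn (r\<^sup>2) = 1" using assms(4) by (intro sgn_pos) simp
  then have "sgn x = sgn y" by (simp only: assms(3) sgn_mult mult_1_left)
  moreover have "sgn z = z" if "z \<in> {-1, 0, 1}" for z :: real using that by auto
  ultimately show ?thesis using assms(1,2) by metis
qed

lemma conjugate_imp_eq:
  assumes adm: "admissible l" "admissible l'"
    and conj: "conjugate (Collect (coord_eqs l)) (Collect (coord_eqs l'))"
  shows "l = l'"
proof -
  obtain \<alpha> \<beta> \<gamma> \<delta> k m where det: "\<alpha> * \<delta> - \<beta> * \<gamma> = 1"
    and A: "\<And>v. coord_eqs l v \<Longrightarrow> coord_eqs l' (adj \<alpha> \<beta> \<gamma> \<delta> k m v)"
    by (rule conjugateE[OF conj]) (rule that)
  note disc = disc_adj[OF det, of k m] and cub = cubic_inv_adj[OF det, of k m]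
  have \<alpha>\<delta>: "\<alpha> \<noteq> 0" "\<alpha> * \<delta> = 1" if "\<gamma> = 0" using det that by (simp_all, force)
  have sig: "label_signature l = label_signature l'"
    using conjugate_signature[OF conj] by (simp add: signature_coord_eqs)
  show ?thesis
  proof (cases l)
    case (S1_2 x)
    then obtain y where l: "l = S1_2 x" "l' = S1_2 y" using sig by (cases l') simp_all
    \<comment> \<open>The third entry of the image of P^t is \<gamma>^2 and must vanish; what is
      left can only rescale the parameter by a square.\<close>
    have "\<gamma> = 0" "k * \<alpha> = 0" "x - k\<^sup>2 / 4 = \<alpha>\<^sup>2 * y"
      using A[of "(1, 0, 0, 0, 0, x)"] by (simp_all add: l adj_def)
    then have xy: "x = \<alpha>\<^sup>2 * y" "\<alpha> \<noteq> 0" using \<alpha>\<delta> by auto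
    have "x = y" by (rule sgn_scale_unique[OF _ _ xy]) (use adm in \<open>simp_all add: l\<close>)
    then show ?thesis by (simp add: l)
  next
    case (S1_3 x)
    then obtain y where l: "l = S1_3 x" "l' = S1_3 y" using sig by (cases l') simp_all
    obtain a b c g p i where v: "adj \<alpha> \<beta> \<gamma> \<delta> k m (0, 1, 0, 0, 0, x) = (a, b, c, g, p, i)"
      by (rule prod_cases6)
    have eqs: "a = 0" "c = 0" "g = 0" "p = 0" "i = b * y"
      using A[of "(0, 1, 0, 0, 0, x)"] by (simp_all add: l v)
    \<comment> \<open>The discriminant leaves b = 1 or b = -1 and the cubic invariant gives x = b y;
      nonnegativity excludes a genuine sign change.\<close>
    have "b\<^sup>2 = 1" "b\<^sup>2 * (b * y) = x"
      using disc[of "(0, 1, 0, 0, 0, x)"] cub[of "(0, 1, 0, 0, 0, x)"] by (simp_all add: v eqs)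
    then have "b = 1 \<or> b = -1" "b * y = x" by (auto simp: power2_eq_1_iff)
    then show ?thesis using adm by (auto simp: l)
  next
    case (S1_4 x)
    then obtain y where l: "l = S1_4 x" "l' = S1_4 y" using sig by (cases l') simp_all
    obtain a b c g p i where v: "adj \<alpha> \<beta> \<gamma> \<delta> k m (1, 0, 1, 0, 0, x) = (a, b, c, g, p, i)"
      by (rule prod_cases6)
    have eqs: "b = 0" "c = a" "g = 0" "p = 0" "i = a * y"
      using A[of "(1, 0, 1, 0, 0, x)"] by (simp_all add: l v)
    have "a = \<alpha>\<^sup>2 + \<beta>\<^sup>2" using v by (simp add: adj_def)
    \<comment> \<open>A definite form keeps its sign under SL(2), which excludes a = -1 and hence
      \<nu> going to -\<nu>.\<close>
    then have "a \<ge> 0" by simp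
    moreover have sq: "a * a = 1" using disc[of "(1, 0, 1, 0, 0, x)"] by (simp add: v eqs)
    ultimately have "a = 1" by (simp add: square_eq_1_iff)
    then show ?thesis using cub[of "(1, 0, 1, 0, 0, x)"] by (simp add: l v eqs)
  next
    case (S2_1 x)
    then obtain y where l: "l = S2_1 x" "l' = S2_1 y" using sig by (cases l') simp_all
    have "\<gamma> = 0" "k * \<alpha> = 0" using A[of "(1, 0, 0, 0, 0, 0)"] by (simp_all add: l adj_def)
    then have "\<gamma> = 0" "k = 0" "\<alpha> * \<delta> = 1" using \<alpha>\<delta> by auto
    then show ?thesis using A[of "(0, 1, 0, 0, 0, x)"] by (simp add: l adj_def)
  next
    case (S2_3 x)
    then obtain y where l: "l = S2_3 x" "l' = S2_3 y" using sig by (cases l') simp_all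
    have "\<gamma> = 0" "x - k\<^sup>2 / 4 = \<alpha>\<^sup>2 * y"
      using A[of "(1, 0, 0, 0, 0, x)"] by (simp_all add: l adj_def)
    moreover have "k = 0" using A[of "(0, 0, 0, 0, 1, 0)"] by (simp add: l adj_def)
    ultimately have xy: "x = \<alpha>\<^sup>2 * y" "\<alpha> \<noteq> 0" using \<alpha>\<delta> by auto
    have "x = y" by (rule sgn_scale_unique[OF _ _ xy]) (use adm in \<open>simp_all add: l\<close>)
    then show ?thesis by (simp add: l)
  next
    case (S2_5 x)
    then obtain y where l: "l = S2_5 x" "l' = S2_5 y" using sig by (cases l') simp_all
    \<comment> \<open>The image of P^x has G^x-coefficient -\<gamma> and central entry -k / 2, and
      both must vanish.\<close>
    have "\<gamma> = 0" "k = 0" using A[of "(0, 0, 0, 0, 1, 0)"] by (simp_all add: l adj_def)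
    then show ?thesis using A[of "(0, 1, 0, 0, 0, x)"] \<alpha>\<delta> by (simp add: l adj_def)
  next
    case (S3_2 x)
    then obtain y where l: "l = S3_2 x" "l' = S3_2 y" using sig by (cases l') simp_all
    have "\<gamma> = 0" "k = 0" using A[of "(0, 0, 0, 0, 1, 0)"] by (simp_all add: l adj_def)
    then show ?thesis using A[of "(0, 1, 0, 0, 0, x)"] \<alpha>\<delta> by (simp add: l adj_def)
  qed (use sig in \<open>cases l'; simp\<close>)+
qed

theorem lemma6:
  shows "(\<forall>l. admissible l \<longrightarrow>
            proper_nonzero_subalgebra (listed l) \<and> dim (listed l) = listed_dim l) \<and>
         (\<forall>s. proper_nonzero_subalgebra s \<longrightarrow>
            (\<exists>l. admissible l \<and> ess_equivalent s (listed l))) \<and>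
         (\<forall>l l'. admissible l \<longrightarrow> admissible l' \<longrightarrow> l \<noteq> l' \<longrightarrow>
            \<not> ess_equivalent (listed l) (listed l'))"
proof (intro conjI allI impI)
  fix l
  show "proper_nonzero_subalgebra (listed l)" by (rule proper_nonzero_subalgebra_listed)
  show "dim (listed l) = listed_dim l"
    unfolding listed_eq_image dim_vfield_of_image dim_coord_eqs ..
next
  fix s assume s: "proper_nonzero_subalgebra s"
  then have "s \<subseteq> range vfield_of"
    by (simp add: proper_nonzero_subalgebra_def lie_subalgebra_def g_ess_eq_range)
  then obtain S where S: "s = vfield_of ` S" by (meson subset_image_iff)
  have "coord_subalg S"
    using s unfolding S proper_nonzero_subalgebra_def lie_subalgebra_image coord_subalg_def by blast
  moreover have "S \<noteq> {0}" "S \<noteq> UNIV"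
    using s vfield_of_zero by (auto simp: S proper_nonzero_subalgebra_def g_ess_eq_range)
  ultimately have "classified S" by (rule coord_subalgebra_classified)
  then show "\<exists>l. admissible l \<and> ess_equivalent s (listed l)"
    unfolding S listed_eq_image ess_equivalent_iff_conjugate classified_def .
next
  fix l l' assume "admissible l" "admissible l'" "l \<noteq> l'"
  then show "\<not> ess_equivalent (listed l) (listed l')"
    unfolding listed_eq_image ess_equivalent_iff_conjugate using conjugate_imp_eq by blast
qed

end
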